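(* Let $\mathbf{x}=\mathbf{A}\boldsymbol{\theta}_0+\mathbf{v}$ be the linear model of the context, with assumptions A1, A2, A6 and A8 of the context in force, and let $\hat{\boldsymbol{\theta}}^N_0=(\mathbf{A}^T\mathbf{A})^{-1}\mathbf{A}^T\mathbf{x}$ be the least squares estimator. Let $\varepsilon>0$ and $r>0$ be given. Then for all $N>N(r,\varepsilon)$, $$P\left(\|\hat{\boldsymbol{\theta}}^N_0-\boldsymbol{\theta}_0\|_\infty>r\right)<\varepsilon,$$ where $N(r,\varepsilon)=\max\{N_1(r,\varepsilon),N_{rand}(\varepsilon)\}$, $$N_1(r,\varepsilon)=\frac{8\alpha^2R^2}{r^2\sigma_{min}^2}\log\frac{2p}{\varepsilon},\qquad N_{rand}(\varepsilon)=\frac{4}{3}\,\frac{(6\sigma_{max}+\sigma_{min})(p\alpha^2+\sigma_{max})}{\sigma_{min}^2}\log\frac{2p}{\varepsilon}.$$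
   Context: Model: $\mathbf{x}=\mathbf{A}\boldsymbol{\theta}_0+\mathbf{v}$, where $\mathbf{x}\in\mathbb{R}^{N\times 1}$ is the output, $\mathbf{A}=(a_{ni})\in\mathbb{R}^{N\times p}$ is a random matrix with rows $\mathbf{a}_n^T$, $n=1,\dots,N$, $\boldsymbol{\theta}_0\in\mathbb{R}^p$ is the true parameter, $\mathbf{v}=(v_1,\dots,v_N)^T$ is the noise, and $N$ is the number of samples. Standing assumptions: the noise is zero mean, $N>p$, and the least squares solution exists ($\mathbf{A}^T\mathbf{A}$ is invertible). $\lambda_{max}(\mathbf B)$ and $\lambda_{min}(\mathbf B)$ denote the largest and smallest eigenvalues of a square matrix $\mathbf B$. Assumptions: A1: $P(|a_{ni}|\le\alpha)=1$ for all $n=1,\dots,N$ and $i=1,\dots,p$. A2: there is a matrix $\mathbf{M}\in\mathbb{R}^{p\times p}$ with $\mathbf{M}=\frac1N E(\mathbf{A}^T\mathbf{A})$ for all $N>0$; write $\sigma_{max}=\lambda_{max}(\mathbf{M})$ and $\sigma_{min}=\lambda_{min}(\mathbf{M})$, with $\sigma_{min}>0$. A6: $(v_n)$ is a martingale difference sequence with respect to a filtration $(F_n)$ (so $v_n$ is $F_n$-measurable), i.e. $E(v_n\mid F_{n-1})=0$, and the $v_n$ are independent of $\mathbf{A}$. A8: the martingale difference sequence is $R$ sub-Gaussian, i.e. $E(e^{sv_n}\mid F_{n-1})\le e^{s^2R^2/2}$ for all $n$ and all $s$.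
   Formalization: The formal theorem additionally assumes that the rows a_1, a_2, … of A are independent (not necessarily identically distributed); without this the claim fails, e.g. for p=1 with all rows equal to one random variable taking the values 1 and 1/100. *)

theory Defs
  imports "HOL-Probability.Probability"
begin

definition eigenvalues :: "real^'n^'n \<Rightarrow> real set" where
  "eigenvalues B = {l. \<exists>u. u \<noteq> 0 \<and> B *v u = l *\<^sub>R u}"

(* Only applied to symmetric matrices, where the set of (real) eigenvalues is finite and nonempty. *)
definition lambda_max :: "real^'n^'n \<Rightarrow> real" where
  "lambda_max B = Max (eigenvalues B)"

definition lambda_min :: "real^'n^'n \<Rightarrow> real" where
  "lambda_min B = Min (eigenvalues B)"

(* The N x p matrix A is given by the first N members (index 1..N) of a sequence a of rows in R^p,
   so that N may vary; gram a N is A^T A and gram_rhs a x N is A^T x, written out entrywise. *)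
definition gram :: "(nat \<Rightarrow> real^'p) \<Rightarrow> nat \<Rightarrow> real^'p^'p" where
  "gram a N = (\<chi> i j. \<Sum>n=1..N. a n $ i * a n $ j)"

definition gram_rhs :: "(nat \<Rightarrow> real^'p) \<Rightarrow> (nat \<Rightarrow> real) \<Rightarrow> nat \<Rightarrow> real^'p" where
  "gram_rhs a x N = (\<chi> i. \<Sum>n=1..N. a n $ i * x n)"

definition least_squares :: "(nat \<Rightarrow> real^'p) \<Rightarrow> (nat \<Rightarrow> real) \<Rightarrow> nat \<Rightarrow> real^'p" where
  "least_squares a x N = matrix_inv (gram a N) *v gram_rhs a x N"

(* The library's indep_var requires X and Y to have the same value type; this is the same notion
   (independence of the generated sigma-algebras) for different value types. *)
definition indep_random_elements ::
    "'w measure \<Rightarrow> 'b measure \<Rightarrow> ('w \<Rightarrow> 'b) \<Rightarrow> 'c measure \<Rightarrow> ('w \<Rightarrow> 'c) \<Rightarrow> bool" where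
  "indep_random_elements \<mu> S X T Y \<longleftrightarrow>
     X \<in> measurable \<mu> S \<and> Y \<in> measurable \<mu> T \<and>
     prob_space.indep_set \<mu> (sets (vimage_algebra (space \<mu>) X S)) (sets (vimage_algebra (space \<mu>) Y T))"

definition martingale_difference ::
    "'w measure \<Rightarrow> (nat \<Rightarrow> 'w measure) \<Rightarrow> (nat \<Rightarrow> 'w \<Rightarrow> real) \<Rightarrow> bool" where
  "martingale_difference \<mu> F v \<longleftrightarrow>
     filtration (space \<mu>) F \<and> (\<forall>n. subalgebra \<mu> (F n)) \<and>
     (\<forall>n\<ge>1. v n \<in> borel_measurable (F n) \<and> integrable \<mu> (v n) \<and>
        (AE \<omega> in \<mu>. real_cond_exp \<mu> (F (n - 1)) (v n) \<omega> = 0))"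

(* nn_cond_exp is [0,\<infinity>]-valued. With real_cond_exp, which takes the value 0 where the conditional
   expectation is infinite, the bound would hold vacuously for non-integrable exponentials. *)
definition cond_sub_gaussian ::
    "'w measure \<Rightarrow> (nat \<Rightarrow> 'w measure) \<Rightarrow> (nat \<Rightarrow> 'w \<Rightarrow> real) \<Rightarrow> real \<Rightarrow> bool" where
  "cond_sub_gaussian \<mu> F v R \<longleftrightarrow>
     (\<forall>n\<ge>1. \<forall>s::real. AE \<omega> in \<mu>.
        nn_cond_exp \<mu> (F (n - 1)) (\<lambda>\<omega>. ennreal (exp (s * v n \<omega>))) \<omega>
          \<le> ennreal (exp (s\<^sup>2 * R\<^sup>2 / 2)))"

definition N1_bound :: "real \<Rightarrow> real \<Rightarrow> nat \<Rightarrow> real \<Rightarrow> real \<Rightarrow> real \<Rightarrow> real" where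
  "N1_bound \<alpha> R p \<sigma>min r \<epsilon> = 8 * \<alpha>\<^sup>2 * R\<^sup>2 / (r\<^sup>2 * \<sigma>min\<^sup>2) * ln (2 * real p / \<epsilon>)"

definition Nrand_bound :: "real \<Rightarrow> nat \<Rightarrow> real \<Rightarrow> real \<Rightarrow> real \<Rightarrow> real" where
  "Nrand_bound \<alpha> p \<sigma>max \<sigma>min \<epsilon> =
     4 / 3 * ((6 * \<sigma>max + \<sigma>min) * (real p * \<alpha>\<^sup>2 + \<sigma>max) / \<sigma>min\<^sup>2) * ln (2 * real p / \<epsilon>)"

end

theory Submission
  imports Defs "HOL-Real_Asymp.Real_Asymp"
begin

text \<open>
  The \<open>i\<close>-th component of the estimation error is \<open>\<Sum> w\<^sub>n v\<^sub>n\<close>, where the weights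
  \<open>w\<^sub>n = a\<^sub>n \<bullet> z\<close> come from the \<open>i\<close>-th column \<open>z\<close> of the inverse of the Gram matrix
  (\<open>least_squares_error\<close>), and \<open>\<Sum> w\<^sub>n\<^sup>2\<close> is the \<open>i\<close>-th diagonal entry of that inverse. The noise is
  independent of the design, so conditionally on the design the weights are constants, and iterated
  conditioning along the filtration shows that the error component is sub-Gaussian with variance
  proxy \<open>R\<^sup>2 \<Sum> w\<^sub>n\<^sup>2\<close> (\<open>sub_gaussian_sum\<close>, \<open>sub_gaussian_random_weights_tail\<close>). When the smallest
  eigenvalue of the Gram matrix is at least \<open>N \<sigma>min / 2\<close>, the proxy is at most
  \<open>2 R\<^sup>2 / (N \<sigma>min)\<close>. As \<open>\<sigma>min \<le> \<alpha>\<^sup>2\<close>, the threshold \<open>N1_bound\<close> then makes the \<open>2 p\<close> tail probabilities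
  sum to at most \<open>\<epsilon> / 2\<close> for \<open>\<epsilon> \<le> 1\<close>; for \<open>\<epsilon> > 1\<close> there is nothing to prove.

  The Gram matrix has a smaller eigenvalue with probability less than \<open>\<epsilon> / 2\<close>, by a matrix Chernoff
  bound with the dimension \<open>p\<close> as its only prefactor (\<open>prob_small_gram_form_le\<close>); the threshold
  \<open>Nrand_bound\<close> comes from a matrix Bernstein inequality, whose exponent is weaker. Matrix
  exponentials are avoided: \<open>exp (- t S)\<close> is replaced by the power \<open>(1 - t S / m)\<^sup>m\<close> with \<open>m\<close> even, and
  \<open>m\<close> tends to infinity at the end. The potential is the trace of this power. Adding a
  row \<open>b\<close> decreases the base by a multiple of \<open>b b\<^sup>T\<close>, and an algebraic second-order expansion
  (\<open>trace_power_rank_one\<close>) bounds the new trace by means of the log-convex moment sequence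
  \<open>b \<bullet> H\<^sup>j b\<close>. Since the new row is independent of the earlier ones and its second moment matrix is at
  least \<open>\<sigma>min\<close>, the expected trace decreases by a constant factor in every step, starting from \<open>p\<close>.
  On the other hand, the trace is at least \<open>(1 - t \<delta> / m)\<^sup>m\<close> whenever the Gram form is at most \<open>\<delta>\<close> at
  some unit vector. Markov's inequality compares the two.
\<close>

section \<open>Moments of a positive semidefinite operator\<close>

text \<open>Operators are plain functions, so that powers are the iterates \<open>H ^^ n\<close> and the library's
  facts about iteration apply.\<close>
definition psd :: "('a::real_inner \<Rightarrow> 'a) \<Rightarrow> bool" where
  "psd H \<longleftrightarrow> linear H \<and> (\<forall>x y. x \<bullet> H y = H x \<bullet> y) \<and> (\<forall>x. 0 \<le> x \<bullet> H x)"

lemma psd_linear: "psd H \<Longrightarrow> linear H"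
  and psd_sym: "psd H \<Longrightarrow> x \<bullet> H y = H x \<bullet> y"
  and psd_nonneg: "psd H \<Longrightarrow> 0 \<le> x \<bullet> H x"
  by (auto simp: psd_def)

text \<open>The quadratic form may be degenerate, so the discriminant argument is split according to
  whether the quadratic in \<open>t\<close> is in fact affine.\<close>
lemma psd_Cauchy_Schwarz:
  assumes "psd H"
  shows "(x \<bullet> H y)\<^sup>2 \<le> (x \<bullet> H x) * (y \<bullet> H y)"
proof -
  define A B C where "A = x \<bullet> H x" and "B = x \<bullet> H y" and "C = y \<bullet> H y"
  have q: "0 \<le> A + 2 * t * B + t\<^sup>2 * C" for t
  proof -
    have "y \<bullet> H x = B"
      using psd_sym[OF assms, of y x] by (simp add: B_def inner_commute)
    then have "(x + t *\<^sub>R y) \<bullet> H (x + t *\<^sub>R y) = A + 2 * t * B + t\<^sup>2 * C"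
      using psd_linear[OF assms]
      by (simp add: linear_add linear_scale inner_add_left inner_add_right A_def B_def C_def
          algebra_simps power2_eq_square)
    then show ?thesis
      using psd_nonneg[OF assms] by metis
  qed
  have "C \<ge> 0"
    using psd_nonneg[OF assms] by (simp add: C_def)
  have "B\<^sup>2 \<le> A * C"
  proof (cases "C = 0")
    case True
    have "B = 0"
    proof (rule ccontr)
      assume "B \<noteq> 0"
      have "A + 2 * (- (A + 1) / (2 * B)) * B = -1"
        using \<open>B \<noteq> 0\<close> by (simp add: field_simps)
      then show False
        using q[of "- (A + 1) / (2 * B)"] True by simp
    qed
    then show ?thesis using True by simp
  next
    case False
    then have "A + 2 * (- B / C) * B + (- B / C)\<^sup>2 * C = A - B\<^sup>2 / C"
      by (simp add: power2_eq_square field_simps)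
    then have "B\<^sup>2 / C \<le> A"
      using q[of "- B / C"] by simp
    then show ?thesis
      using False \<open>C \<ge> 0\<close> by (simp add: field_simps)
  qed
  then show ?thesis by (simp add: A_def B_def C_def)
qed

lemma linear_funpow: "linear H \<Longrightarrow> linear (H ^^ n)" for H :: "'a::real_vector \<Rightarrow> 'a"
  by (induction n) (auto simp: id_def[symmetric] linear_id intro: linear_compose)

lemma psd_funpow_sym:
  assumes "psd H"
  shows "x \<bullet> (H ^^ n) y = (H ^^ n) x \<bullet> y"
proof (induction n arbitrary: x y)
  case (Suc n)
  have "x \<bullet> (H ^^ Suc n) y = H x \<bullet> (H ^^ n) y"
    by (simp add: psd_sym[OF assms])
  also have "\<dots> = (H ^^ n) (H x) \<bullet> y"
    by (rule Suc)
  finally show ?case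
    by (simp add: funpow_swap1)
qed simp

lemma funpow_add_apply: "(f ^^ (m + n)) x = (f ^^ m) ((f ^^ n) x)"
  by (simp add: funpow_add)

text \<open>A moment \<open>b \<bullet> (H ^^ n) b\<close> is a value of the form \<open>1\<close> or of the form \<open>H\<close> at the iterate
  \<open>(H ^^ (n div 2)) b\<close>. This replaces the spectral measure of \<open>H\<close> at \<open>b\<close>: every fact about
  moments below is reduced to one of these two cases.\<close>
lemma inner_funpow_even:
  assumes "psd H"
  shows "b \<bullet> (H ^^ (k + k)) b = (H ^^ k) b \<bullet> (H ^^ k) b"
    and "b \<bullet> (H ^^ (Suc (k + k))) b = (H ^^ k) b \<bullet> H ((H ^^ k) b)"
proof -
  show "b \<bullet> (H ^^ (k + k)) b = (H ^^ k) b \<bullet> (H ^^ k) b"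
    by (simp add: funpow_add_apply psd_funpow_sym[OF assms])
  have "(H ^^ (Suc (k + k))) b = (H ^^ k) (H ((H ^^ k) b))"
    by (simp add: funpow_add_apply funpow_swap1)
  then show "b \<bullet> (H ^^ (Suc (k + k))) b = (H ^^ k) b \<bullet> H ((H ^^ k) b)"
    by (simp add: psd_funpow_sym[OF assms])
qed

lemma even_odd_double_cases:
  fixes n :: nat
  obtains k where "n = k + k" | k where "n = Suc (k + k)"
  by (metis add_Suc_right add.commute evenE mult_2 oddE plus_1_eq_Suc)

lemma inner_funpow_nonneg:
  assumes "psd H"
  shows "0 \<le> b \<bullet> (H ^^ n) b"
  by (cases n rule: even_odd_double_cases)
    (simp_all only: inner_funpow_even[OF assms] psd_nonneg[OF assms] inner_ge_zero)

text \<open>Cauchy--Schwarz for the two forms of the preceding reduction.\<close>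
lemma inner_funpow_log_convex:
  assumes "psd H"
  shows "(b \<bullet> (H ^^ Suc n) b)\<^sup>2 \<le> (b \<bullet> (H ^^ n) b) * (b \<bullet> (H ^^ Suc (Suc n)) b)"
proof (cases n rule: even_odd_double_cases)
  case (1 k)
  define y where "y = (H ^^ k) b"
  have "b \<bullet> (H ^^ Suc (Suc n)) b = H y \<bullet> H y"
    using inner_funpow_even(1)[OF assms, of b "Suc k"] 1 by (simp add: y_def)
  then show ?thesis
    using Cauchy_Schwarz_ineq[of y "H y"] inner_funpow_even[OF assms, of b k]
    unfolding 1 y_def by metis
next
  case (2 k)
  define y where "y = (H ^^ k) b"
  have "b \<bullet> (H ^^ Suc (Suc n)) b = H y \<bullet> H (H y)"
    using inner_funpow_even(2)[OF assms, of b "Suc k"] 2 by (simp add: y_def)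
  moreover have "b \<bullet> (H ^^ Suc n) b = y \<bullet> H (H y)"
    using inner_funpow_even(1)[OF assms, of b "Suc k"] 2 psd_sym[OF assms] by (simp add: y_def)
  moreover have "b \<bullet> (H ^^ n) b = y \<bullet> H y"
    using inner_funpow_even(2)[OF assms, of b k] unfolding 2 by (simp add: y_def)
  ultimately show ?thesis
    using psd_Cauchy_Schwarz[OF assms, of y "H y"] by simp
qed

text \<open>Log-convexity makes the ratios \<open>h (j + 1) / h j\<close> increase, so moving a unit from the smaller
  index to the larger one increases \<open>h i * h j\<close>; repeat until the smaller index is \<open>0\<close>.
  The ratios are written as products since terms may vanish.\<close>
lemma log_convex_supermultiplicative:
  fixes h :: "nat \<Rightarrow> real"
  assumes nonneg: "\<And>n. 0 \<le> h n"
    and lc: "\<And>n. (h (Suc n))\<^sup>2 \<le> h n * h (Suc (Suc n))"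
  shows "h i * h j \<le> h 0 * h (i + j)"
proof -
  have step: "h (Suc i) * h j \<le> h i * h (Suc j)" if "i \<le> j" for i j
    using that
  proof (induction j rule: dec_induct)
    case base
    show ?case by (simp add: mult.commute)
  next
    case (step j)
    show ?case
    proof (cases "h j = 0")
      case True
      then have "h (Suc j) = 0"
        using lc[of j] by simp
      then show ?thesis using nonneg by simp
    next
      case False
      then have pos: "h j > 0"
        using nonneg[of j] by simp
      have "(h (Suc i) * h (Suc j)) * h j = (h (Suc i) * h j) * h (Suc j)"
        by simp
      also have "\<dots> \<le> (h i * h (Suc j)) * h (Suc j)"
        by (rule mult_right_mono[OF step.IH nonneg])
      also have "\<dots> = h i * (h (Suc j))\<^sup>2"
        by (simp add: power2_eq_square)
      also have "\<dots> \<le> h i * (h j * h (Suc (Suc j)))"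
        by (rule mult_left_mono[OF lc nonneg])
      finally have "(h (Suc i) * h (Suc j)) * h j \<le> (h i * h (Suc (Suc j))) * h j"
        by (simp add: mult_ac)
      then show ?thesis
        using pos by simp
    qed
  qed
  have ordered: "h i * h j \<le> h 0 * h (i + j)" if "i \<le> j" for i j
    using that
  proof (induction i arbitrary: j)
    case (Suc i)
    have "h (Suc i) * h j \<le> h i * h (Suc j)"
      using Suc.prems by (intro step) simp
    also have "\<dots> \<le> h 0 * h (i + Suc j)"
      using Suc.prems by (intro Suc.IH) simp
    finally show ?case by simp
  qed simp
  show ?thesis
    using ordered[of i j] ordered[of j i] by (cases "i \<le> j") (simp_all add: add.commute mult.commute)
qed

lemma inner_funpow_mult_le:
  assumes "psd H"
  shows "(b \<bullet> (H ^^ i) b) * (b \<bullet> (H ^^ j) b) \<le> (b \<bullet> b) * (b \<bullet> (H ^^ (i + j)) b)"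
  using log_convex_supermultiplicative[of "\<lambda>n. b \<bullet> (H ^^ n) b" i j]
    inner_funpow_nonneg[OF assms] inner_funpow_log_convex[OF assms] by simp

lemma inner_funpow_Suc_ge:
  assumes H: "psd H" and lower: "\<And>x. \<rho> * (x \<bullet> x) \<le> x \<bullet> H x"
  shows "\<rho> * (b \<bullet> (H ^^ n) b) \<le> b \<bullet> (H ^^ Suc n) b"
proof (cases "b = 0")
  case True
  then show ?thesis by simp
next
  case False
  have "(b \<bullet> b) * (\<rho> * (b \<bullet> (H ^^ n) b)) = (\<rho> * (b \<bullet> b)) * (b \<bullet> (H ^^ n) b)"
    by simp
  also have "\<dots> \<le> (b \<bullet> H b) * (b \<bullet> (H ^^ n) b)"
    by (rule mult_right_mono[OF lower inner_funpow_nonneg[OF H]])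
  also have "\<dots> \<le> (b \<bullet> b) * (b \<bullet> (H ^^ Suc n) b)"
    using inner_funpow_mult_le[OF H, of b 1 n] by simp
  finally show ?thesis
    using False by simp
qed

text \<open>For odd exponents this needs \<open>H\<^sup>2 \<le> H\<close>, which follows from \<open>0 \<le> H \<le> 1\<close> by
  Cauchy--Schwarz in the form of \<open>H\<close>.\<close>
lemma inner_funpow_Suc_le:
  assumes H: "psd H" and upper: "\<And>x. x \<bullet> H x \<le> x \<bullet> x"
  shows "b \<bullet> (H ^^ Suc n) b \<le> b \<bullet> (H ^^ n) b"
proof (cases n rule: even_odd_double_cases)
  case (1 k)
  then show ?thesis
    by (simp only: inner_funpow_even[OF H] upper)
next
  case (2 k)
  define y where "y = (H ^^ k) b"
  have sq: "H y \<bullet> H y \<le> y \<bullet> H y"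
  proof (cases "H y = 0")
    case False
    have "(H y \<bullet> H y)\<^sup>2 = (y \<bullet> H (H y))\<^sup>2"
      by (simp add: psd_sym[OF H])
    also have "\<dots> \<le> (y \<bullet> H y) * (H y \<bullet> H (H y))"
      by (rule psd_Cauchy_Schwarz[OF H])
    also have "\<dots> \<le> (y \<bullet> H y) * (H y \<bullet> H y)"
      by (rule mult_left_mono[OF upper psd_nonneg[OF H]])
    finally show ?thesis
      using False by (simp add: power2_eq_square)
  qed simp
  have "b \<bullet> (H ^^ Suc n) b = H y \<bullet> H y"
    using inner_funpow_even(1)[OF H, of b "Suc k"] 2 by (simp add: y_def)
  moreover have "b \<bullet> (H ^^ n) b = y \<bullet> H y"
    using inner_funpow_even(2)[OF H, of b k] unfolding 2 by (simp add: y_def)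
  ultimately show ?thesis
    using sq by simp
qed

text \<open>Jensen's inequality for the spectral measure of \<open>H\<close> at the unit vector \<open>u\<close>. It bounds the
  trace of a power from below on the event that the Gram form is small somewhere.\<close>
lemma power_inner_le_inner_funpow:
  assumes H: "psd H" and u: "u \<bullet> u = 1"
  shows "(u \<bullet> H u) ^ n \<le> u \<bullet> (H ^^ n) u"
proof (induction n)
  case (Suc n)
  have "(u \<bullet> H u) ^ Suc n \<le> (u \<bullet> H u) * (u \<bullet> (H ^^ n) u)"
    using Suc psd_nonneg[OF H] by (simp add: mult_left_mono)
  also have "\<dots> \<le> u \<bullet> (H ^^ Suc n) u"
    using inner_funpow_mult_le[OF H, of u 1 n] u by simp
  finally show ?case .
qed (simp add: u)

section \<open>The trace of a power under a rank-one decrease\<close>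

definition tr :: "('a::euclidean_space \<Rightarrow> 'a) \<Rightarrow> real" where
  "tr f = (\<Sum>i\<in>Basis. i \<bullet> f i)"

text \<open>Replaces one factor \<open>H\<close> by \<open>G = H - c b b\<^sup>T\<close> in a mixed product \<open>H\<^sup>k\<^sup>+\<^sup>1 G\<^sup>j\<close>; the error has
  rank one and therefore splits into a product of two inner products.\<close>
lemma rank_one_exchange:
  assumes "linear H" and G: "\<And>x. G x = H x - (c * (b \<bullet> x)) *\<^sub>R b"
  shows "x \<bullet> (H ^^ Suc k) ((G ^^ j) y) - x \<bullet> (H ^^ k) ((G ^^ Suc j) y)
     = c * (b \<bullet> (G ^^ j) y) * (x \<bullet> (H ^^ k) b)"
proof -
  have "(H ^^ Suc k) ((G ^^ j) y) - (H ^^ k) ((G ^^ Suc j) y)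
      = (H ^^ k) (H ((G ^^ j) y) - G ((G ^^ j) y))"
    using linear_funpow[OF assms(1), of k] by (simp add: linear_diff funpow_swap1)
  also have "\<dots> = (H ^^ k) ((c * (b \<bullet> (G ^^ j) y)) *\<^sub>R b)"
    by (simp add: G)
  also have "\<dots> = (c * (b \<bullet> (G ^^ j) y)) *\<^sub>R (H ^^ k) b"
    using linear_funpow[OF assms(1), of k] by (simp add: linear_scale)
  finally show ?thesis
    by (metis inner_diff_right inner_scaleR_right)
qed

lemma rank_one_telescope:
  assumes "linear H" and G: "\<And>x. G x = H x - (c * (b \<bullet> x)) *\<^sub>R b" and "j \<le> n"
  shows "x \<bullet> (H ^^ n) y - x \<bullet> (H ^^ (n - j)) ((G ^^ j) y)
     = (\<Sum>i<j. c * (b \<bullet> (G ^^ i) y) * (x \<bullet> (H ^^ (n - Suc i)) b))"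
  using \<open>j \<le> n\<close>
proof (induction j)
  case (Suc j)
  have "n - j = Suc (n - Suc j)"
    using Suc.prems by simp
  then show ?case
    using Suc rank_one_exchange[OF assms(1,2), of x "n - Suc j" j y] by simp
qed simp

text \<open>A second-order Taylor estimate of the trace of \<open>(H - c b b\<^sup>T)\<^sup>n\<close>, and the substitute for the
  Golden--Thompson inequality. Telescoping from \<open>H\<^sup>n\<close> to \<open>G\<^sup>n\<close> gives mixed moments
  \<open>b \<bullet> H\<^sup>k G\<^sup>j b\<close>, and telescoping each of these back to a pure moment of \<open>H\<close> gives the quadratic
  error. The error terms \<open>(b \<bullet> G\<^sup>i b) (b \<bullet> H\<^sup>m\<^sup>-\<^sup>i b)\<close> are at most \<open>(b \<bullet> b) (b \<bullet> H\<^sup>m b)\<close>, because a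
  third telescoping shows \<open>b \<bullet> G\<^sup>i b \<le> b \<bullet> H\<^sup>i b\<close> and the moments of \<open>H\<close> are
  supermultiplicative.\<close>
lemma trace_power_rank_one:
  fixes b :: "'a::euclidean_space"
  assumes H: "psd H" and G': "psd G" and G: "\<And>x. G x = H x - (c * (b \<bullet> x)) *\<^sub>R b"
    and c: "0 \<le> c"
  shows "tr (G ^^ (m + 2)) \<le> tr (H ^^ (m + 2)) - c * real (m + 2) * (b \<bullet> (H ^^ (m + 1)) b)
           + c\<^sup>2 * (real (m + 2))\<^sup>2 / 2 * (b \<bullet> b) * (b \<bullet> (H ^^ m) b)"
proof -
  define h where "h = (\<lambda>n. b \<bullet> (H ^^ n) b)"
  define g where "g = (\<lambda>n. b \<bullet> (G ^^ n) b)"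
  have hn: "0 \<le> h n" for n
    by (simp add: h_def inner_funpow_nonneg[OF H])
  have gn: "0 \<le> g n" for n
    by (simp add: g_def inner_funpow_nonneg[OF G'])
  note tele = rank_one_telescope[OF psd_linear[OF H] G]
  have gh: "g i \<le> h i" for i
  proof -
    have "h i - g i = (\<Sum>l<i. c * g l * h (i - Suc l))"
      using tele[of i i b b] by (simp add: h_def g_def)
    moreover have "\<dots> \<ge> 0"
      using c gn hn by (intro sum_nonneg) simp
    ultimately show ?thesis by simp
  qed
  have mixed: "h (m + 1) - c * real j * ((b \<bullet> b) * h m) \<le> b \<bullet> (H ^^ (m + 1 - j)) ((G ^^ j) b)"
    if j: "j \<le> m + 1" for j
  proof -
    have "h (m + 1) - b \<bullet> (H ^^ (m + 1 - j)) ((G ^^ j) b) = (\<Sum>i<j. c * g i * h (m + 1 - Suc i))"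
      using tele[OF j, of b b] by (simp add: h_def g_def)
    also have "\<dots> \<le> (\<Sum>i<j. c * ((b \<bullet> b) * h m))"
    proof (rule sum_mono)
      fix i assume "i \<in> {..<j}"
      then have i: "i \<le> m" using j by simp
      have "g i * h (m - i) \<le> h i * h (m - i)"
        by (rule mult_right_mono[OF gh hn])
      also have "\<dots> \<le> (b \<bullet> b) * h m"
        using inner_funpow_mult_le[OF H, of b i "m - i"] i by (simp add: h_def)
      finally show "c * g i * h (m + 1 - Suc i) \<le> c * ((b \<bullet> b) * h m)"
        using c by (simp add: mult.assoc mult_left_mono)
    qed
    also have "\<dots> = c * real j * ((b \<bullet> b) * h m)"
      by simp
    finally show ?thesis by simp
  qed
  have "tr (H ^^ (m + 2)) - tr (G ^^ (m + 2))
     = (\<Sum>x\<in>Basis. \<Sum>j<m+2. c * (b \<bullet> (G ^^ j) x) * (x \<bullet> (H ^^ (m + 2 - Suc j)) b))"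
    using tele[of "m+2" "m+2"] by (simp add: tr_def sum_subtractf[symmetric])
  also have "\<dots> = (\<Sum>j<m+2. \<Sum>x\<in>Basis. c * (b \<bullet> (G ^^ j) x) * (x \<bullet> (H ^^ (m + 2 - Suc j)) b))"
    by (rule sum.swap)
  also have "\<dots> = (\<Sum>j<m+2. c * (b \<bullet> (H ^^ (m + 1 - j)) ((G ^^ j) b)))"
  proof (rule sum.cong[OF refl])
    fix j
    have "(\<Sum>x\<in>Basis. c * (b \<bullet> (G ^^ j) x) * (x \<bullet> (H ^^ (m + 2 - Suc j)) b))
        = (\<Sum>x\<in>Basis. c * (((H ^^ (m + 1 - j)) b \<bullet> x) * ((G ^^ j) b \<bullet> x)))"
      by (rule sum.cong) (simp_all add: psd_funpow_sym[OF G', of b] inner_commute[of _ "(H ^^ _) b"])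
    also have "\<dots> = c * ((H ^^ (m + 1 - j)) b \<bullet> (G ^^ j) b)"
      by (simp only: sum_distrib_left[symmetric] euclidean_inner[symmetric])
    finally show "(\<Sum>x\<in>Basis. c * (b \<bullet> (G ^^ j) x) * (x \<bullet> (H ^^ (m + 2 - Suc j)) b))
        = c * (b \<bullet> (H ^^ (m + 1 - j)) ((G ^^ j) b))"
      by (simp add: psd_funpow_sym[OF H, of b])
  qed
  also have "\<dots> \<ge> (\<Sum>j<m+2. c * (h (m + 1) - c * real j * ((b \<bullet> b) * h m)))"
    using c mixed by (intro sum_mono mult_left_mono) auto
  also (xtrans) have "(\<Sum>j<m+2. c * (h (m + 1) - c * real j * ((b \<bullet> b) * h m)))
      = c * real (m + 2) * h (m + 1) - c\<^sup>2 * ((b \<bullet> b) * h m) * (\<Sum>j<m+2. real j)"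
    by (simp add: sum_subtractf sum_distrib_left right_diff_distrib power2_eq_square mult_ac
        del: sum.lessThan_Suc lessThan_Suc)
  finally have diff: "c * real (m + 2) * h (m + 1) - c\<^sup>2 * ((b \<bullet> b) * h m) * (\<Sum>j<m+2. real j)
      \<le> tr (H ^^ (m + 2)) - tr (G ^^ (m + 2))" .
  have gauss: "(\<Sum>j<n. real j) \<le> (real n)\<^sup>2 / 2" for n
    by (induction n) (auto simp: power2_eq_square field_simps)
  have "c\<^sup>2 * ((b \<bullet> b) * h m) * (\<Sum>j<m+2. real j)
      \<le> c\<^sup>2 * ((b \<bullet> b) * h m) * ((real (m + 2))\<^sup>2 / 2)"
    by (rule mult_left_mono[OF gauss]) (simp add: hn)
  with diff have "c * real (m + 2) * h (m + 1) - c\<^sup>2 * ((b \<bullet> b) * h m) * ((real (m + 2))\<^sup>2 / 2)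
      \<le> tr (H ^^ (m + 2)) - tr (G ^^ (m + 2))"
    by linarith
  then show ?thesis
    by (simp add: h_def algebra_simps)
qed

section \<open>The contraction built from a sum of rank-one forms\<close>

definition gram_form :: "(nat \<Rightarrow> 'a::real_inner) \<Rightarrow> nat \<Rightarrow> 'a \<Rightarrow> real" where
  "gram_form y n x = (\<Sum>k=1..n. (y k \<bullet> x)\<^sup>2)"

text \<open>The operator \<open>1 - c \<Sum> y\<^sub>k y\<^sub>k\<^sup>T\<close>. With \<open>c = t / m\<close>, its \<open>m\<close>-th power is a polynomial
  version of the exponential \<open>exp (- t \<Sum> y\<^sub>k y\<^sub>k\<^sup>T)\<close>.\<close>
definition shrink :: "real \<Rightarrow> (nat \<Rightarrow> 'a::real_inner) \<Rightarrow> nat \<Rightarrow> 'a \<Rightarrow> 'a" where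
  "shrink c y n x = x - (\<Sum>k=1..n. (c * (y k \<bullet> x)) *\<^sub>R y k)"

lemma inner_shrink: "x \<bullet> shrink c y n x = x \<bullet> x - c * gram_form y n x"
  by (simp add: shrink_def gram_form_def inner_diff_right inner_sum_right sum_distrib_left
      power2_eq_square inner_commute mult_ac)

lemma gram_form_nonneg: "0 \<le> gram_form y n x"
  by (simp add: gram_form_def sum_nonneg)

lemma gram_form_le:
  assumes "\<And>k. k \<in> {1..n} \<Longrightarrow> y k \<bullet> y k \<le> L"
  shows "gram_form y n x \<le> real n * L * (x \<bullet> x)"
proof -
  have "gram_form y n x \<le> (\<Sum>k=1..n. L * (x \<bullet> x))"
    unfolding gram_form_def
    by (intro sum_mono order_trans[OF Cauchy_Schwarz_ineq] mult_right_mono assms) auto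
  then show ?thesis by simp
qed

lemma shrink_lower:
  assumes "\<And>k. k \<in> {1..n} \<Longrightarrow> y k \<bullet> y k \<le> L" and "0 \<le> c"
  shows "(1 - c * (real n * L)) * (x \<bullet> x) \<le> x \<bullet> shrink c y n x"
  using mult_left_mono[OF gram_form_le[OF assms(1)] assms(2), where x1 = x]
  by (simp add: inner_shrink algebra_simps)

lemma psd_shrink:
  assumes y: "\<And>k. k \<in> {1..n} \<Longrightarrow> y k \<bullet> y k \<le> L" and "0 \<le> c" and "c * (real n * L) \<le> 1"
  shows "psd (shrink c y n)"
  unfolding psd_def
proof (intro conjI allI)
  show "linear (shrink c y n)"
    by (rule linearI)
      (simp_all add: shrink_def inner_add_right scaleR_add_left sum.distrib distrib_left
        scaleR_diff_right scaleR_sum_right mult_ac)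
  show "x \<bullet> shrink c y n z = shrink c y n x \<bullet> z" for x z
    by (simp add: shrink_def inner_diff_right inner_diff_left inner_sum_right inner_sum_left
        inner_commute mult_ac)
  show "0 \<le> x \<bullet> shrink c y n x" for x
    by (rule order_trans[OF _ shrink_lower[OF y \<open>0 \<le> c\<close>]]) (use assms(3) in auto)
qed

text \<open>Even powers are used throughout because \<open>H\<^sup>2\<^sup>l = H\<^sup>l H\<^sup>l\<close> turns the trace and the quadratic form
  into sums of squares in the vectors \<open>(H ^^ l) i\<close>, which in the probabilistic argument are
  independent of the next row.\<close>
lemma tr_power_even:
  assumes "psd H"
  shows "tr (H ^^ (l + l)) = (\<Sum>i\<in>Basis. (H ^^ l) i \<bullet> (H ^^ l) i)"
  by (simp add: tr_def inner_funpow_even[OF assms])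

lemma inner_funpow_even_Basis:
  fixes y :: "'a::euclidean_space"
  assumes "psd H"
  shows "y \<bullet> (H ^^ (l + l)) y = (\<Sum>i\<in>Basis. ((H ^^ l) i \<bullet> y)\<^sup>2)"
proof -
  have "(H ^^ l) y \<bullet> i = (H ^^ l) i \<bullet> y" for i
    using psd_funpow_sym[OF assms, of y l i] by (simp add: inner_commute)
  then have "(H ^^ l) y \<bullet> (H ^^ l) y = (\<Sum>i\<in>Basis. ((H ^^ l) i \<bullet> y)\<^sup>2)"
    by (subst euclidean_inner) (simp add: power2_eq_square)
  then show ?thesis
    by (simp add: inner_funpow_even[OF assms])
qed

lemma inner_funpow_le_tr:
  assumes "psd H"
  shows "u \<bullet> (H ^^ (l + l)) u \<le> tr (H ^^ (l + l)) * (u \<bullet> u)"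
proof -
  have "u \<bullet> (H ^^ (l + l)) u = (\<Sum>i\<in>Basis. ((H ^^ l) i \<bullet> u)\<^sup>2)"
    by (rule inner_funpow_even_Basis[OF assms])
  also have "\<dots> \<le> (\<Sum>i\<in>Basis. ((H ^^ l) i \<bullet> (H ^^ l) i) * (u \<bullet> u))"
    by (intro sum_mono Cauchy_Schwarz_ineq)
  finally show ?thesis
    by (simp add: tr_power_even[OF assms] sum_distrib_right)
qed

text \<open>One step of the recursion. In \<open>trace_power_rank_one\<close> the first-order term has the
  moment of order \<open>m + 1\<close> and the error the moment of order \<open>m\<close>; the bounds \<open>1 - c n L \<le> H \<le> 1\<close> allow
  both to be compared with the moment of order \<open>m + 2\<close>, and \<open>c n L\<close> vanishes as \<open>m\<close> grows.\<close>
lemma tr_shrink_Suc: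
  fixes y :: "nat \<Rightarrow> 'a::euclidean_space"
  assumes y: "\<And>k. k \<in> {1..Suc n} \<Longrightarrow> y k \<bullet> y k \<le> L"
    and t: "0 \<le> t" "t * real (Suc n) * L \<le> real (m + 2)" and L: "0 \<le> L"
    and \<kappa>: "\<kappa> \<le> t * (1 - t * real n * L / real (m + 2)) - t\<^sup>2 * L / 2" "0 \<le> \<kappa>"
  shows "tr (shrink (t / real (m + 2)) y (Suc n) ^^ (m + 2))
    \<le> tr (shrink (t / real (m + 2)) y n ^^ (m + 2))
       - \<kappa> * (y (Suc n) \<bullet> (shrink (t / real (m + 2)) y n ^^ (m + 2)) (y (Suc n)))"
proof -
  define M c where "M = real (m + 2)" and "c = t / M"
  define H b where "H = shrink c y n" and "b = y (Suc n)"
  define h where "h = (\<lambda>j. b \<bullet> (H ^^ j) b)"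
  have "M > 0" by (simp add: M_def)
  have c: "0 \<le> c" and cn: "c * (real (Suc n) * L) \<le> 1"
    using t \<open>M > 0\<close> by (simp_all add: c_def M_def field_simps)
  have "c * (real n * L) \<le> c * (real (Suc n) * L)"
    using c L by (intro mult_left_mono mult_right_mono) auto
  then have cn': "c * (real n * L) \<le> 1"
    using cn by linarith
  have H: "psd H"
    unfolding H_def using y c cn' by (intro psd_shrink[where L = L]) auto
  have G': "psd (shrink c y (Suc n))"
    using y c cn by (intro psd_shrink[where L = L]) auto
  have G: "shrink c y (Suc n) x = H x - (c * (b \<bullet> x)) *\<^sub>R b" for x
    by (simp add: shrink_def H_def b_def)
  have hn: "0 \<le> h j" for j
    by (simp add: h_def inner_funpow_nonneg[OF H])
  have lower: "(1 - c * (real n * L)) * h m \<le> h (m + 1)"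
    using inner_funpow_Suc_ge[OF H, of "1 - c * (real n * L)" b m] shrink_lower[of n y L c] y c
    by (simp add: h_def H_def)
  have upper: "h (Suc j) \<le> h j" for j
    unfolding h_def
    by (rule inner_funpow_Suc_le[OF H])
      (use mult_nonneg_nonneg[OF c gram_form_nonneg] in \<open>simp add: H_def inner_shrink\<close>)
  have hm: "h (m + 2) \<le> h m"
    using upper[of m] upper[of "Suc m"] by simp
  have "tr (shrink c y (Suc n) ^^ (m + 2))
      \<le> tr (H ^^ (m + 2)) - c * M * h (m + 1) + c\<^sup>2 * M\<^sup>2 / 2 * (b \<bullet> b) * h m"
    unfolding M_def h_def by (rule trace_power_rank_one[OF H G' G c])
  also have "\<dots> = tr (H ^^ (m + 2)) - t * h (m + 1) + t\<^sup>2 / 2 * (b \<bullet> b) * h m"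
    using \<open>M > 0\<close> by (simp add: c_def power_divide)
  also have "\<dots> \<le> tr (H ^^ (m + 2)) - t * ((1 - c * (real n * L)) * h m) + t\<^sup>2 / 2 * L * h m"
    using lower t(1) y[of "Suc n"] hn
    by (intro add_mono diff_mono mult_left_mono mult_right_mono) (auto simp: b_def)
  also have "\<dots> = tr (H ^^ (m + 2)) - (t * (1 - t * real n * L / M) - t\<^sup>2 * L / 2) * h m"
    by (simp add: c_def algebra_simps)
  also have "\<dots> \<le> tr (H ^^ (m + 2)) - \<kappa> * h m"
    using \<kappa>(1) hn by (intro diff_left_mono mult_right_mono) (auto simp: M_def)
  also have "\<dots> \<le> tr (H ^^ (m + 2)) - \<kappa> * h (m + 2)"
    using \<kappa>(2) hm by (simp add: mult_left_mono)
  finally show ?thesis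
    by (simp only: h_def H_def b_def c_def M_def)
qed

section \<open>Independent pairs\<close>
lemma (in prob_space) nn_integral_product_distr:
  assumes X[measurable]: "X \<in> measurable M S" and Y[measurable]: "Y \<in> measurable M T"
    and joint: "distr M S X \<Otimes>\<^sub>M distr M T Y = distr M (S \<Otimes>\<^sub>M T) (\<lambda>\<omega>. (X \<omega>, Y \<omega>))"
    and f[measurable]: "f \<in> borel_measurable (S \<Otimes>\<^sub>M T)"
  shows "(\<integral>\<^sup>+\<omega>. f (X \<omega>, Y \<omega>) \<partial>M) = (\<integral>\<^sup>+\<omega>. (\<integral>\<^sup>+\<omega>'. f (X \<omega>, Y \<omega>') \<partial>M) \<partial>M)"
proof -
  interpret Y: prob_space "distr M T Y"
    by (rule prob_space_distr) simp
  have "(\<integral>\<^sup>+\<omega>. f (X \<omega>, Y \<omega>) \<partial>M) = (\<integral>\<^sup>+z. f z \<partial>(distr M S X \<Otimes>\<^sub>M distr M T Y))"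
    unfolding joint by (subst nn_integral_distr) simp_all
  also have "\<dots> = (\<integral>\<^sup>+x. (\<integral>\<^sup>+y. f (x, y) \<partial>distr M T Y) \<partial>distr M S X)"
  proof (rule Y.nn_integral_fst[symmetric])
    show "f \<in> borel_measurable (distr M S X \<Otimes>\<^sub>M distr M T Y)"
      using f unfolding joint by simp
  qed
  also have "\<dots> = (\<integral>\<^sup>+\<omega>. (\<integral>\<^sup>+y. f (X \<omega>, y) \<partial>distr M T Y) \<partial>M)"
    by (rule nn_integral_distr[OF X Y.borel_measurable_nn_integral_fst])
      (use f in \<open>simp cong: measurable_cong_sets\<close>)
  also have "\<dots> = (\<integral>\<^sup>+\<omega>. (\<integral>\<^sup>+\<omega>'. f (X \<omega>, Y \<omega>') \<partial>M) \<partial>M)"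
  proof (rule nn_integral_cong)
    fix \<omega> assume \<omega>: "\<omega> \<in> space M"
    then have [simp]: "X \<omega> \<in> space S" by (rule measurable_space[OF X])
    have "(\<lambda>y. f (X \<omega>, y)) \<in> borel_measurable T"
      by measurable
    then show "(\<integral>\<^sup>+y. f (X \<omega>, y) \<partial>distr M T Y) = (\<integral>\<^sup>+\<omega>'. f (X \<omega>, Y \<omega>') \<partial>M)"
      by (subst nn_integral_distr) simp_all
  qed
  finally show ?thesis .
qed

text \<open>By Fubini, the vector \<open>W\<close> may be treated as a constant in the lower bound on the second moment of \<open>Y\<close>.\<close>
lemma (in prob_space) second_moment_indep_ge:
  fixes W Y :: "'a \<Rightarrow> 'b::euclidean_space"
  assumes indep: "indep_var borel W borel Y"
    and W: "AE \<omega> in M. W \<omega> \<bullet> W \<omega> \<le> C" and Y: "AE \<omega> in M. Y \<omega> \<bullet> Y \<omega> \<le> L"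
    and \<sigma>: "0 \<le> \<sigma>" "\<And>w. \<sigma> * (w \<bullet> w) \<le> expectation (\<lambda>\<omega>. (w \<bullet> Y \<omega>)\<^sup>2)"
  shows "\<sigma> * expectation (\<lambda>\<omega>. W \<omega> \<bullet> W \<omega>) \<le> expectation (\<lambda>\<omega>. (W \<omega> \<bullet> Y \<omega>)\<^sup>2)"
    and "integrable M (\<lambda>\<omega>. (W \<omega> \<bullet> Y \<omega>)\<^sup>2)"
proof -
  have mW[measurable]: "W \<in> borel_measurable M" and mY[measurable]: "Y \<in> borel_measurable M"
    using indep_var_rv1[OF indep] indep_var_rv2[OF indep] by auto
  have iW: "integrable M (\<lambda>\<omega>. W \<omega> \<bullet> W \<omega>)"
    by (rule integrable_const_bound[of _ C]) (use W in auto)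
  have sq: "AE \<omega> in M. (w \<bullet> Y \<omega>)\<^sup>2 \<le> (w \<bullet> w) * L" for w
    using Y by eventually_elim
      (blast intro: order_trans[OF Cauchy_Schwarz_ineq] mult_left_mono inner_ge_zero)
  have iwY: "integrable M (\<lambda>\<omega>. (w \<bullet> Y \<omega>)\<^sup>2)" for w
    by (rule integrable_const_bound[of _ "(w \<bullet> w) * L"]) (use sq in auto)
  have "AE \<omega> in M. (W \<omega> \<bullet> Y \<omega>)\<^sup>2 \<le> C * L"
    using W Y
  proof eventually_elim
    case (elim \<omega>)
    have "(W \<omega> \<bullet> Y \<omega>)\<^sup>2 \<le> (W \<omega> \<bullet> W \<omega>) * (Y \<omega> \<bullet> Y \<omega>)"
      by (rule Cauchy_Schwarz_ineq)
    also have "\<dots> \<le> C * L"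
      using elim order_trans[OF inner_ge_zero elim(1)] by (intro mult_mono) auto
    finally show ?case .
  qed
  then show iWY: "integrable M (\<lambda>\<omega>. (W \<omega> \<bullet> Y \<omega>)\<^sup>2)"
    by (intro integrable_const_bound[of _ "C * L"]) auto
  have joint: "distr M borel W \<Otimes>\<^sub>M distr M borel Y = distr M (borel \<Otimes>\<^sub>M borel) (\<lambda>\<omega>. (W \<omega>, Y \<omega>))"
    using indep unfolding indep_var_distribution_eq by simp
  have "ennreal (\<sigma> * expectation (\<lambda>\<omega>. W \<omega> \<bullet> W \<omega>)) = (\<integral>\<^sup>+\<omega>. ennreal (\<sigma> * (W \<omega> \<bullet> W \<omega>)) \<partial>M)"
    by (subst nn_integral_eq_integral) (use \<sigma>(1) iW in auto)
  also have "\<dots> \<le> (\<integral>\<^sup>+\<omega>. (\<integral>\<^sup>+\<omega>'. ennreal ((W \<omega> \<bullet> Y \<omega>')\<^sup>2) \<partial>M) \<partial>M)"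
    by (intro nn_integral_mono, subst nn_integral_eq_integral[OF iwY])
      (auto intro: ennreal_leI \<sigma>(2))
  also have "\<dots> = (\<integral>\<^sup>+\<omega>. ennreal ((W \<omega> \<bullet> Y \<omega>)\<^sup>2) \<partial>M)"
    using nn_integral_product_distr[OF mW mY joint, of "\<lambda>(w, y). ennreal ((w \<bullet> y)\<^sup>2)"] by simp
  also have "\<dots> = ennreal (expectation (\<lambda>\<omega>. (W \<omega> \<bullet> Y \<omega>)\<^sup>2))"
    by (rule nn_integral_eq_integral[OF iWY]) simp
  finally show "\<sigma> * expectation (\<lambda>\<omega>. W \<omega> \<bullet> W \<omega>) \<le> expectation (\<lambda>\<omega>. (W \<omega> \<bullet> Y \<omega>)\<^sup>2)"
    by (subst (asm) ennreal_le_iff) (auto intro: integral_nonneg_AE)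
qed

section \<open>The lower tail of a sum of independent rank-one forms\<close>
lemma inner_funpow_le:
  assumes "psd H" and "\<And>x. x \<bullet> H x \<le> x \<bullet> x"
  shows "b \<bullet> (H ^^ n) b \<le> b \<bullet> b"
  by (induction n) (use inner_funpow_Suc_le[OF assms, of b] in \<open>auto intro: order_trans\<close>)

lemma shrink_upper: "0 \<le> c \<Longrightarrow> x \<bullet> shrink c y n x \<le> x \<bullet> x"
  using mult_nonneg_nonneg[OF _ gram_form_nonneg, of c y n x] by (simp add: inner_shrink)

lemma borel_measurable_shrink:
  fixes a :: "nat \<Rightarrow> 'w \<Rightarrow> 'a::euclidean_space"
  assumes a: "\<And>k. k \<in> {1..n} \<Longrightarrow> a k \<in> borel_measurable N"
    and w: "w \<in> borel_measurable N"
  shows "(\<lambda>\<omega>. shrink c (\<lambda>k. a k \<omega>) n (w \<omega>)) \<in> borel_measurable N"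
  unfolding shrink_def
  by (intro borel_measurable_diff borel_measurable_sum borel_measurable_scaleR
      borel_measurable_times borel_measurable_inner borel_measurable_const a w)

lemma borel_measurable_shrink_funpow:
  fixes a :: "nat \<Rightarrow> 'w \<Rightarrow> 'a::euclidean_space"
  assumes a: "\<And>k. k \<in> {1..n} \<Longrightarrow> a k \<in> borel_measurable N"
  shows "(\<lambda>\<omega>. (shrink c (\<lambda>k. a k \<omega>) n ^^ l) x) \<in> borel_measurable N"
  by (induction l) (auto intro!: borel_measurable_shrink a)

lemma shrink_restrict: "shrink c (restrict y {1..n}) n = shrink c y n"
  by (auto simp: shrink_def intro!: ext sum.cong)

lemma (in prob_space) indep_shrink_funpow:
  fixes a :: "nat \<Rightarrow> 'a \<Rightarrow> 'b::euclidean_space"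
  assumes indep: "indep_vars (\<lambda>_. borel) a {1..}"
  shows "indep_var borel (\<lambda>\<omega>. (shrink c (\<lambda>k. a k \<omega>) n ^^ l) x) borel (a (Suc n))"
proof -
  have "indep_var (PiM {1..n} (\<lambda>_. borel)) (\<lambda>\<omega>. restrict (\<lambda>k. a k \<omega>) {1..n})
          (PiM {Suc n} (\<lambda>_. borel)) (\<lambda>\<omega>. restrict (\<lambda>k. a k \<omega>) {Suc n})"
    using indep by (rule indep_var_restrict) auto
  then have "indep_var borel ((\<lambda>y. (shrink c y n ^^ l) x) \<circ> (\<lambda>\<omega>. restrict (\<lambda>k. a k \<omega>) {1..n}))
       borel ((\<lambda>y. y (Suc n)) \<circ> (\<lambda>\<omega>. restrict (\<lambda>k. a k \<omega>) {Suc n}))"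
    by (rule indep_var_compose)
      (auto intro!: borel_measurable_shrink_funpow[where a = "\<lambda>k y. y k"] measurable_component_singleton)
  then show ?thesis
    by (simp add: comp_def shrink_restrict del: One_nat_def)
qed

locale bounded_independent_rows = prob_space +
  fixes a :: "nat \<Rightarrow> 'a \<Rightarrow> 'b::euclidean_space" and L \<sigma> :: real
  assumes indep: "indep_vars (\<lambda>_. borel) a {1..}"
    and bounded: "\<And>k. 1 \<le> k \<Longrightarrow> AE \<omega> in M. a k \<omega> \<bullet> a k \<omega> \<le> L"
    and second_moment: "\<And>k w. 1 \<le> k \<Longrightarrow> \<sigma> * (w \<bullet> w) \<le> expectation (\<lambda>\<omega>. (w \<bullet> a k \<omega>)\<^sup>2)"
    and L_pos: "0 < L" and \<sigma>_nonneg: "0 \<le> \<sigma>"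
begin

lemma a_measurable: "1 \<le> k \<Longrightarrow> a k \<in> borel_measurable M"
  using indep by (auto simp: indep_vars_def2)

lemma AE_all_bounded: "AE \<omega> in M. \<forall>k\<in>{1..n}. a k \<omega> \<bullet> a k \<omega> \<le> L"
  by (rule AE_finite_allI) (auto intro: bounded)

text \<open>With \<open>H = H\<^sub>n\<close> and the new row \<open>b\<close>, the decrease \<open>b \<bullet> H\<^sup>2\<^sup>l b\<close> of the trace is the sum over the
  basis of the \<open>(H\<^sup>l i \<bullet> b)\<^sup>2\<close>. Since \<open>H\<^sup>l i\<close> depends on the earlier rows only, its expectation is at
  least \<open>\<sigma>\<close> times that of the trace itself.\<close>
lemma expectation_tr_shrink_Suc:
  fixes l :: nat and t \<kappa> :: real and n :: nat
  defines "H \<equiv> \<lambda>n \<omega>. shrink (t / real (l + l)) (\<lambda>k. a k \<omega>) n"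
  assumes l: "1 \<le> l" and t: "0 \<le> t" "t * real (Suc n) * L \<le> real (l + l)"
    and \<kappa>: "\<kappa> \<le> t * (1 - t * real n * L / real (l + l)) - t\<^sup>2 * L / 2" "0 \<le> \<kappa>"
  shows "expectation (\<lambda>\<omega>. tr (H (Suc n) \<omega> ^^ (l + l)))
       \<le> (1 - \<kappa> * \<sigma>) * expectation (\<lambda>\<omega>. tr (H n \<omega> ^^ (l + l)))"
    and "integrable M (\<lambda>\<omega>. tr (H (Suc n) \<omega> ^^ (l + l)))"
proof -
  define c where "c = t / real (l + l)"
  define m where "m = l + l - 2"
  have lm: "l + l = m + 2"
    using l by (simp add: m_def)
  have c: "0 \<le> c" and "c * (real (Suc n) * L) \<le> 1"
    using t l by (simp_all add: c_def field_simps)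
  moreover have "c * (real k * L) \<le> c * (real (Suc n) * L)" if "k \<le> Suc n" for k
    using that c L_pos by (intro mult_left_mono mult_right_mono) auto
  ultimately have cn: "c * (real k * L) \<le> 1" if "k \<le> Suc n" for k
    using that by (meson order_trans)
  have H: "H k \<omega> = shrink c (\<lambda>j. a j \<omega>) k" for k \<omega>
    by (simp add: H_def c_def)
  have psd: "psd (H k \<omega>)" if "k \<le> Suc n" and "\<forall>j\<in>{1..Suc n}. a j \<omega> \<bullet> a j \<omega> \<le> L" for k \<omega>
    unfolding H using that c cn by (intro psd_shrink[where L = L]) auto
  have upper: "x \<bullet> H k \<omega> x \<le> x \<bullet> x" for x k \<omega>
    unfolding H by (rule shrink_upper[OF c])
  have W[measurable]: "(\<lambda>\<omega>. (H k \<omega> ^^ j) x) \<in> borel_measurable M" for k j x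
    unfolding H by (rule borel_measurable_shrink_funpow) (simp add: a_measurable)
  have WW: "AE \<omega> in M. (H k \<omega> ^^ l) x \<bullet> (H k \<omega> ^^ l) x \<le> x \<bullet> x" if "k \<le> Suc n" for k x
    using AE_all_bounded[of "Suc n"]
  proof eventually_elim
    case (elim \<omega>)
    have "(H k \<omega> ^^ l) x \<bullet> (H k \<omega> ^^ l) x = x \<bullet> (H k \<omega> ^^ (l + l)) x"
      by (rule inner_funpow_even(1)[OF psd[OF that elim], symmetric])
    also have "\<dots> \<le> x \<bullet> x"
      by (rule inner_funpow_le[OF psd[OF that elim] upper])
    finally show ?case .
  qed
  have iW: "integrable M (\<lambda>\<omega>. (H k \<omega> ^^ l) x \<bullet> (H k \<omega> ^^ l) x)" if "k \<le> Suc n" for k x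
    by (rule integrable_const_bound[of _ "x \<bullet> x"]) (use WW[OF that] in auto)
  have tr: "AE \<omega> in M. tr (H k \<omega> ^^ (l + l)) = (\<Sum>i\<in>Basis. (H k \<omega> ^^ l) i \<bullet> (H k \<omega> ^^ l) i)"
    if "k \<le> Suc n" for k
    using AE_all_bounded[of "Suc n"] by eventually_elim (rule tr_power_even[OF psd[OF that]])
  have mtr[measurable]: "(\<lambda>\<omega>. tr (H k \<omega> ^^ j)) \<in> borel_measurable M" for k j
    unfolding tr_def by measurable
  have itr: "integrable M (\<lambda>\<omega>. tr (H k \<omega> ^^ (l + l)))" if "k \<le> Suc n" for k
    using iW[OF that] by (subst integrable_cong_AE[OF _ _ tr[OF that]]) auto
  then show "integrable M (\<lambda>\<omega>. tr (H (Suc n) \<omega> ^^ (l + l)))" by simp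
  have Etr: "expectation (\<lambda>\<omega>. tr (H n \<omega> ^^ (l + l)))
      = (\<Sum>i\<in>Basis. expectation (\<lambda>\<omega>. (H n \<omega> ^^ l) i \<bullet> (H n \<omega> ^^ l) i))"
    using iW[of n] by (subst integral_cong_AE[OF _ _ tr]) (auto intro!: Bochner_Integration.integral_sum)
  have indep': "indep_var borel (\<lambda>\<omega>. (H n \<omega> ^^ l) x) borel (a (Suc n))" for x
    unfolding H by (rule indep_shrink_funpow[OF indep])
  note sm = second_moment_indep_ge[OF indep' WW[of n] bounded[of "Suc n"] \<sigma>_nonneg second_moment[of "Suc n"]]
  have step: "AE \<omega> in M. tr (H (Suc n) \<omega> ^^ (l + l)) \<le> tr (H n \<omega> ^^ (l + l))
       - \<kappa> * (\<Sum>i\<in>Basis. ((H n \<omega> ^^ l) i \<bullet> a (Suc n) \<omega>)\<^sup>2)"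
    using AE_all_bounded[of "Suc n"]
  proof eventually_elim
    case (elim \<omega>)
    define b where "b = a (Suc n) \<omega>"
    have p: "psd (H n \<omega>)" by (rule psd) (use elim in auto)
    have "tr (H (Suc n) \<omega> ^^ (l + l)) \<le> tr (H n \<omega> ^^ (l + l)) - \<kappa> * (b \<bullet> (H n \<omega> ^^ (l + l)) b)"
      using tr_shrink_Suc[of n "\<lambda>k. a k \<omega>" L t m \<kappa>] elim t \<kappa> L_pos
      unfolding H c_def lm b_def by auto
    also have "b \<bullet> (H n \<omega> ^^ (l + l)) b = (\<Sum>i\<in>Basis. ((H n \<omega> ^^ l) i \<bullet> b)\<^sup>2)"
      by (rule inner_funpow_even_Basis[OF p])
    finally show ?case by (simp add: b_def)
  qed
  have "expectation (\<lambda>\<omega>. tr (H (Suc n) \<omega> ^^ (l + l)))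
     \<le> expectation (\<lambda>\<omega>. tr (H n \<omega> ^^ (l + l)) - \<kappa> * (\<Sum>i\<in>Basis. ((H n \<omega> ^^ l) i \<bullet> a (Suc n) \<omega>)\<^sup>2))"
    using itr sm(2) step by (intro integral_mono_AE) auto
  also have "\<dots> = expectation (\<lambda>\<omega>. tr (H n \<omega> ^^ (l + l)))
      - \<kappa> * (\<Sum>i\<in>Basis. expectation (\<lambda>\<omega>. ((H n \<omega> ^^ l) i \<bullet> a (Suc n) \<omega>)\<^sup>2))"
    using itr sm(2) by simp
  also have "\<dots> \<le> expectation (\<lambda>\<omega>. tr (H n \<omega> ^^ (l + l)))
      - \<kappa> * (\<Sum>i\<in>Basis. \<sigma> * expectation (\<lambda>\<omega>. (H n \<omega> ^^ l) i \<bullet> (H n \<omega> ^^ l) i))"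
    using \<kappa>(2) sm(1) by (intro diff_left_mono mult_left_mono sum_mono) auto
  also have "\<dots> = (1 - \<kappa> * \<sigma>) * expectation (\<lambda>\<omega>. tr (H n \<omega> ^^ (l + l)))"
    by (simp add: Etr sum_distrib_left[symmetric] left_diff_distrib)
  finally show "expectation (\<lambda>\<omega>. tr (H (Suc n) \<omega> ^^ (l + l)))
       \<le> (1 - \<kappa> * \<sigma>) * expectation (\<lambda>\<omega>. tr (H n \<omega> ^^ (l + l)))" .
qed

lemma expectation_tr_shrink_le:
  fixes l N :: nat and t \<kappa> :: real
  assumes l: "1 \<le> l" and t: "0 \<le> t" "t * real N * L \<le> real (l + l)"
    and \<kappa>: "\<kappa> \<le> t * (1 - t * real N * L / real (l + l)) - t\<^sup>2 * L / 2" "0 \<le> \<kappa>"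
  shows "expectation (\<lambda>\<omega>. tr (shrink (t / real (l + l)) (\<lambda>k. a k \<omega>) N ^^ (l + l)))
       \<le> real DIM('b) * exp (- (\<kappa> * \<sigma> * real N))" (is "expectation (?T N) \<le> _")
    and "integrable M (\<lambda>\<omega>. tr (shrink (t / real (l + l)) (\<lambda>k. a k \<omega>) N ^^ (l + l)))"
proof -
  have id: "(shrink c y 0 ^^ j) x = x" for c y j and x :: 'b
    by (induction j) (auto simp: shrink_def)
  have mono: "t * real n * L \<le> t * real N * L" if "n \<le> N" for n
    using that t L_pos by (intro mult_left_mono mult_right_mono) auto
  have \<kappa>': "\<kappa> \<le> t * (1 - t * real n * L / real (l + l)) - t\<^sup>2 * L / 2" if "n \<le> N" for n
  proof -
    have "t * (1 - t * real N * L / real (l + l)) \<le> t * (1 - t * real n * L / real (l + l))"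
      using mono[OF that] t(1) by (intro mult_left_mono diff_left_mono divide_right_mono) auto
    then show ?thesis using \<kappa>(1) by linarith
  qed
  note rec = expectation_tr_shrink_Suc[OF l t(1) order_trans[OF mono t(2)] \<kappa>' \<kappa>(2)]
  have "0 \<le> expectation (?T n) \<and> expectation (?T n) \<le> real DIM('b) * exp (- (\<kappa> * \<sigma> * real n))
      \<and> integrable M (?T n)" if "n \<le> N" for n
    using that
  proof (induction n)
    case 0
    show ?case
      by (simp add: tr_def id prob_space inner_Basis)
  next
    case (Suc n)
    then have IH: "0 \<le> expectation (?T n)" "expectation (?T n) \<le> real DIM('b) * exp (- (\<kappa> * \<sigma> * real n))"
      by auto
    have "AE \<omega> in M. 0 \<le> ?T (Suc n) \<omega>"
      using AE_all_bounded[of "Suc n"]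
    proof eventually_elim
      case (elim \<omega>)
      have "psd (shrink (t / real (l + l)) (\<lambda>k. a k \<omega>) (Suc n))"
        using elim t mono[OF Suc.prems] l
        by (intro psd_shrink[where L = L]) (auto simp: field_simps)
      then show ?case
        by (simp add: tr_power_even sum_nonneg)
    qed
    then have pos: "0 \<le> expectation (?T (Suc n))"
      by (rule integral_nonneg_AE)
    have "expectation (?T (Suc n)) \<le> (1 - \<kappa> * \<sigma>) * expectation (?T n)"
      using Suc.prems by (intro rec(1)) auto
    also have "\<dots> \<le> exp (- (\<kappa> * \<sigma>)) * (real DIM('b) * exp (- (\<kappa> * \<sigma> * real n)))"
      using IH exp_ge_add_one_self[of "- (\<kappa> * \<sigma>)"] by (intro mult_mono) auto
    also have "\<dots> = real DIM('b) * exp (- (\<kappa> * \<sigma> * real (Suc n)))"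
      by (simp add: exp_add[symmetric] algebra_simps)
    finally show ?case
      using pos rec(2) Suc.prems by auto
  qed
  then show "expectation (?T N) \<le> real DIM('b) * exp (- (\<kappa> * \<sigma> * real N))" "integrable M (?T N)"
    by auto
qed

text \<open>Markov's inequality for the trace. The scale \<open>t = 1 / (2 L)\<close> maximises the exponent
  \<open>t / 2 - t\<^sup>2 L / 2\<close> that remains for \<open>\<delta> = N \<sigma> / 2\<close> when \<open>l\<close> is large. The event \<open>B\<close> is any
  measurable part of the event that the form is small somewhere; whether that event is itself
  measurable is left open.\<close>
lemma prob_small_gram_form_power:
  fixes l N :: nat and \<delta> :: real
  assumes B: "B \<in> events"
    and small: "AE \<omega> in M. \<omega> \<in> B \<longrightarrow> (\<exists>u. u \<noteq> 0 \<and> gram_form (\<lambda>k. a k \<omega>) N u \<le> \<delta> * (u \<bullet> u))"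
    and l: "1 \<le> l" "N \<le> l" "\<delta> / (2 * L) \<le> real (l + l)"
  shows "prob B * (1 - \<delta> / (2 * L) / real (l + l)) ^ (l + l)
    \<le> real DIM('b) * exp (- ((3 / (8 * L) - real N / (8 * L * real l)) * \<sigma> * real N))"
proof -
  define t where "t = 1 / (2 * L)"
  define c where "c = t / real (l + l)"
  define q where "q = (1 - \<delta> / (2 * L) / real (l + l)) ^ (l + l)"
  define \<kappa> where "\<kappa> = 3 / (8 * L) - real N / (8 * L * real l)"
  have t: "0 \<le> t" "t * real N * L \<le> real (l + l)"
    using L_pos l by (auto simp: t_def)
  have \<kappa>_eq: "\<kappa> = t * (1 - t * real N * L / real (l + l)) - t\<^sup>2 * L / 2"
    using L_pos l by (simp add: \<kappa>_def t_def field_simps power2_eq_square)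
  have "\<kappa> = (3 - real N / real l) / (8 * L)"
    using L_pos l by (simp add: \<kappa>_def field_simps)
  moreover have "real N / real l \<le> 1"
    using l by simp
  ultimately have \<kappa>0: "0 \<le> \<kappa>"
    using L_pos by simp
  note T = expectation_tr_shrink_le[OF l(1) t eq_refl[OF \<kappa>_eq] \<kappa>0]
  have c0: "0 \<le> c" and cN: "c * (real N * L) \<le> 1"
    using t l by (simp_all add: c_def field_simps)
  have "AE \<omega> in M. indicator B \<omega> * q \<le> tr (shrink c (\<lambda>k. a k \<omega>) N ^^ (l + l))"
    using small AE_all_bounded[of N]
  proof eventually_elim
    case (elim \<omega>)
    let ?H = "shrink c (\<lambda>k. a k \<omega>) N"
    have H: "psd ?H"
      using elim c0 cN by (intro psd_shrink[where L = L]) auto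
    show ?case
    proof (cases "\<omega> \<in> B")
      case False
      then show ?thesis
        by (simp add: tr_power_even[OF H] sum_nonneg)
    next
      case True
      then obtain u where u: "u \<noteq> 0" "gram_form (\<lambda>k. a k \<omega>) N u \<le> \<delta> * (u \<bullet> u)"
        using elim by auto
      define w where "w = u /\<^sub>R norm u"
      have w: "w \<bullet> w = 1"
        using u(1) by (simp add: w_def dot_square_norm power2_eq_square)
      have "gram_form (\<lambda>k. a k \<omega>) N w = gram_form (\<lambda>k. a k \<omega>) N u / (norm u)\<^sup>2"
        by (simp add: gram_form_def w_def power_mult_distrib sum_divide_distrib divide_inverse
            power_inverse sum_distrib_left mult.commute)
      also have "\<dots> \<le> \<delta>"
        using u by (simp add: dot_square_norm divide_le_eq)
      finally have "gram_form (\<lambda>k. a k \<omega>) N w \<le> \<delta>" .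
      then have "c * gram_form (\<lambda>k. a k \<omega>) N w \<le> \<delta> / (2 * L) / real (l + l)"
        using mult_left_mono[OF _ c0] by (fastforce simp: c_def t_def)
      then have "1 - \<delta> / (2 * L) / real (l + l) \<le> w \<bullet> ?H w"
        by (simp add: inner_shrink w)
      moreover have "0 \<le> 1 - \<delta> / (2 * L) / real (l + l)"
        using l(1) divide_right_mono[OF l(3), of "real (l + l)"] by simp
      ultimately have "q \<le> (w \<bullet> ?H w) ^ (l + l)"
        unfolding q_def by (rule power_mono)
      also have "\<dots> \<le> w \<bullet> (?H ^^ (l + l)) w"
        by (rule power_inner_le_inner_funpow[OF H w])
      also have "\<dots> \<le> tr (?H ^^ (l + l))"
        using inner_funpow_le_tr[OF H, of w l] w by simp
      finally show ?thesis
        using True by simp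
    qed
  qed
  moreover have "integrable M (\<lambda>\<omega>. indicator B \<omega> * q)"
    using B by (intro integrable_mult_left integrable_const_bound[of _ 1]) auto
  ultimately have "expectation (\<lambda>\<omega>. indicator B \<omega> * q) \<le> real DIM('b) * exp (- (\<kappa> * \<sigma> * real N))"
    using T unfolding c_def by (intro order_trans[OF integral_mono_AE T(1)]) auto
  then show ?thesis
    using B by (simp add: q_def \<kappa>_def)
qed

text \<open>A matrix Chernoff bound, obtained from the polynomial bounds as \<open>(1 - x / m)\<^sup>m\<close> tends to
  \<open>exp (- x)\<close>.\<close>
lemma prob_small_gram_form_le:
  assumes B: "B \<in> events"
    and small: "AE \<omega> in M. \<omega> \<in> B \<longrightarrow>
      (\<exists>u. u \<noteq> 0 \<and> gram_form (\<lambda>k. a k \<omega>) N u \<le> real N * \<sigma> / 2 * (u \<bullet> u))"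
  shows "prob B \<le> real DIM('b) * exp (- (real N * \<sigma> / (8 * L)))"
proof -
  define x where "x = real N * \<sigma> / 2 / (2 * L)"
  have dbl: "filterlim (\<lambda>l::nat. l + l) sequentially sequentially"
    by (rule filterlim_at_top_mono[OF filterlim_ident]) auto
  have lim1: "(\<lambda>l. prob B * (1 - x / real (l + l)) ^ (l + l)) \<longlonglongrightarrow> prob B * exp (- x)"
    using filterlim_compose[OF tendsto_exp_limit_sequentially[of "- x"] dbl]
    by (intro tendsto_mult tendsto_const) simp
  have lim2: "(\<lambda>l. real DIM('b) * exp (- ((3 / (8 * L) - real N / (8 * L * real l)) * \<sigma> * real N)))
       \<longlonglongrightarrow> real DIM('b) * exp (- ((3 / (8 * L) - 0) * \<sigma> * real N))"
  proof (intro tendsto_intros)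
    show "(\<lambda>l. real N / (8 * L * real l)) \<longlonglongrightarrow> 0"
      using L_pos by real_asymp
  qed
  have "\<forall>\<^sub>F l in sequentially. 1 \<le> l \<and> N \<le> l \<and> x \<le> real (l + l)"
  proof -
    obtain K :: nat where "x \<le> real K"
      using real_arch_simple by blast
    then show ?thesis
      unfolding eventually_sequentially by (intro exI[of _ "Suc (N + K)"]) auto
  qed
  then have "\<forall>\<^sub>F l in sequentially. prob B * (1 - x / real (l + l)) ^ (l + l)
      \<le> real DIM('b) * exp (- ((3 / (8 * L) - real N / (8 * L * real l)) * \<sigma> * real N))"
    by eventually_elim (use prob_small_gram_form_power[OF B small] in \<open>auto simp: x_def\<close>)
  then have "prob B * exp (- x) \<le> real DIM('b) * exp (- ((3 / (8 * L) - 0) * \<sigma> * real N))"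
    by (rule tendsto_le[OF sequentially_bot lim2 lim1])
  then have "prob B \<le> real DIM('b) * exp (- ((3 / (8 * L) - 0) * \<sigma> * real N)) * exp x"
    by (simp add: exp_minus field_simps)
  also have "\<dots> = real DIM('b) * exp (- (real N * \<sigma> / (8 * L)))"
    unfolding mult.assoc exp_add[symmetric]
    using L_pos by (simp add: x_def field_simps)
  finally show ?thesis .
qed

end

section \<open>Extreme eigenvalues of a symmetric matrix\<close>
lemma symmetric_matrix_inner:
  fixes B :: "real^'n^'n"
  assumes "transpose B = B"
  shows "x \<bullet> (B *v y) = (B *v x) \<bullet> y"
  by (metis assms dot_lmul_matrix transpose_matrix_vector)

text \<open>At a minimiser \<open>u\<close> of the Rayleigh quotient the positive semidefinite form of \<open>B - l\<close> vanishes,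
  so by Cauchy--Schwarz \<open>u\<close> is in its kernel.\<close>
lemma rayleigh_minimum_eigenvalue:
  fixes B :: "real^'n^'n"
  assumes sym: "transpose B = B"
  obtains l where "l \<in> eigenvalues B" "\<And>x. l * (x \<bullet> x) \<le> x \<bullet> (B *v x)"
proof -
  have "continuous_on (sphere 0 1) (\<lambda>x. x \<bullet> (B *v x))"
    by (intro continuous_intros linear_continuous_on matrix_vector_mul_bounded_linear)
  moreover have "sphere 0 1 \<noteq> ({} :: (real^'n) set)"
    by simp
  ultimately obtain u where u: "u \<in> sphere 0 1"
    and min: "\<And>y. y \<in> sphere 0 1 \<Longrightarrow> u \<bullet> (B *v u) \<le> y \<bullet> (B *v y)"
    using continuous_attains_inf[OF compact_sphere] by blast
  define l where "l = u \<bullet> (B *v u)"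
  have uu: "u \<bullet> u = 1"
    using u by (simp add: dot_square_norm)
  have le: "l * (x \<bullet> x) \<le> x \<bullet> (B *v x)" for x
  proof (cases "x = 0")
    case False
    define y where "y = x /\<^sub>R norm x"
    have "l \<le> y \<bullet> (B *v y)"
      unfolding l_def by (rule min) (simp add: y_def False)
    also have "\<dots> = x \<bullet> (B *v x) / (norm x)\<^sup>2"
      by (simp add: y_def matrix_vector_mult_scaleR power2_eq_square divide_inverse mult_ac)
    finally show ?thesis
      using False by (simp add: dot_square_norm field_simps)
  qed simp
  define C where "C = (\<lambda>x. B *v x - l *\<^sub>R x)"
  have psd: "psd C"
    unfolding psd_def
  proof (intro conjI allI)
    show "linear C"
      by (rule linearI)
        (simp_all add: C_def matrix_vector_right_distrib matrix_vector_mult_scaleR algebra_simps)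
    show "x \<bullet> C y = C x \<bullet> y" for x y
      by (simp add: C_def inner_diff_right inner_diff_left symmetric_matrix_inner[OF sym])
    show "0 \<le> x \<bullet> C x" for x
      using le[of x] by (simp add: C_def inner_diff_right)
  qed
  have "u \<bullet> C u = 0"
    by (simp add: C_def inner_diff_right l_def uu)
  then have "(C u \<bullet> C u)\<^sup>2 \<le> 0"
    using psd_Cauchy_Schwarz[OF psd, of "C u" u] by simp
  then have "B *v u = l *\<^sub>R u"
    by (simp add: C_def)
  moreover have "u \<noteq> 0"
    using uu by auto
  ultimately have "l \<in> eigenvalues B"
    by (auto simp: eigenvalues_def)
  then show thesis
    using le that by blast
qed

text \<open>Needed because \<open>Min\<close> and \<open>Max\<close> are meaningful on finite sets only.\<close>
lemma finite_eigenvalues: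
  fixes B :: "real^'n^'n"
  assumes sym: "transpose B = B"
  shows "finite (eigenvalues B)"
proof -
  have "\<forall>l\<in>eigenvalues B. \<exists>u. u \<noteq> 0 \<and> B *v u = l *\<^sub>R u"
    by (simp add: eigenvalues_def)
  from bchoice[OF this] obtain e
    where e: "\<And>l. l \<in> eigenvalues B \<Longrightarrow> e l \<noteq> 0 \<and> B *v e l = l *\<^sub>R e l"
    by blast
  have orth: "e l \<bullet> e k = 0" if "l \<in> eigenvalues B" "k \<in> eigenvalues B" "l \<noteq> k" for l k
    using symmetric_matrix_inner[OF sym, of "e l" "e k"] e[OF that(1)] e[OF that(2)] that(3) by simp
  have inj: "inj_on e (eigenvalues B)"
    using orth e by (metis inj_onI inner_eq_zero_iff)
  have "pairwise orthogonal (e ` eigenvalues B)"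
    using orth by (auto simp: pairwise_def orthogonal_def)
  then show ?thesis
    using inj pairwise_orthogonal_imp_finite finite_imageD by blast
qed

lemma lambda_min_le_rayleigh:
  assumes "transpose B = B"
  shows "lambda_min B * (x \<bullet> x) \<le> x \<bullet> (B *v x)"
proof -
  obtain l where l: "l \<in> eigenvalues B" "\<And>x. l * (x \<bullet> x) \<le> x \<bullet> (B *v x)"
    using rayleigh_minimum_eigenvalue[OF assms] by blast
  have "lambda_min B \<le> l"
    unfolding lambda_min_def by (rule Min_le[OF finite_eigenvalues[OF assms] l(1)])
  then show ?thesis
    using l(2)[of x] mult_right_mono[of "lambda_min B" l "x \<bullet> x"] by (meson inner_ge_zero order_trans)
qed

lemma lambda_min_le_lambda_max:
  fixes B :: "real^'n^'n"
  assumes "transpose B = B"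
  shows "lambda_min B \<le> lambda_max B"
proof -
  obtain l where "l \<in> eigenvalues B"
    using rayleigh_minimum_eigenvalue[OF assms] by blast
  then show ?thesis
    unfolding lambda_min_def lambda_max_def
    using finite_eigenvalues[OF assms] by (meson Max_ge Min_le order_trans)
qed

section \<open>Sub-Gaussian noise with independent random weights\<close>

lemma (in prob_space) indep_random_elements_joint:
  assumes "indep_random_elements M S X T Y"
  shows "X \<in> measurable M S" "Y \<in> measurable M T"
    and "distr M T Y \<Otimes>\<^sub>M distr M S X = distr M (T \<Otimes>\<^sub>M S) (\<lambda>\<omega>. (Y \<omega>, X \<omega>))"
proof -
  show X[measurable]: "X \<in> measurable M S" and Y[measurable]: "Y \<in> measurable M T"
    using assms by (auto simp: indep_random_elements_def)
  interpret X: prob_space "distr M S X" by (rule prob_space_distr) simp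
  interpret Y: prob_space "distr M T Y" by (rule prob_space_distr) simp
  show "distr M T Y \<Otimes>\<^sub>M distr M S X = distr M (T \<Otimes>\<^sub>M S) (\<lambda>\<omega>. (Y \<omega>, X \<omega>))"
  proof (rule pair_measure_eqI)
    show "sigma_finite_measure (distr M T Y)" "sigma_finite_measure (distr M S X)" by unfold_locales
    fix B A assume "B \<in> sets (distr M T Y)" "A \<in> sets (distr M S X)"
    then have [measurable]: "B \<in> sets T" "A \<in> sets S" by auto
    have "prob ((X -` A \<inter> space M) \<inter> (Y -` B \<inter> space M))
        = prob (X -` A \<inter> space M) * prob (Y -` B \<inter> space M)"
      using assms unfolding indep_random_elements_def
      by (intro indep_setD[where A = "sets (vimage_algebra (space M) X S)"
            and B = "sets (vimage_algebra (space M) Y T)"] in_vimage_algebra) auto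
    moreover have "(\<lambda>\<omega>. (Y \<omega>, X \<omega>)) -` (B \<times> A) \<inter> space M = (X -` A \<inter> space M) \<inter> (Y -` B \<inter> space M)"
      by auto
    ultimately show "emeasure (distr M T Y) B * emeasure (distr M S X) A
        = emeasure (distr M (T \<Otimes>\<^sub>M S) (\<lambda>\<omega>. (Y \<omega>, X \<omega>))) (B \<times> A)"
      by (simp add: emeasure_distr emeasure_eq_measure ennreal_mult[symmetric] mult.commute)
  qed simp
qed

lemma (in prob_space) sub_gaussian_sum:
  assumes md: "martingale_difference M F v" and sg: "cond_sub_gaussian M F v R"
  shows "(\<integral>\<^sup>+\<omega>. ennreal (exp (\<Sum>n=1..N. w n * v n \<omega>)) \<partial>M)
    \<le> ennreal (exp (R\<^sup>2 / 2 * (\<Sum>n=1..N. (w n)\<^sup>2)))"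
proof (induction N)
  case 0
  show ?case by (simp add: emeasure_space_1)
next
  case (Suc N)
  have filt: "filtration (space M) F" and sub: "subalgebra M (F n)" for n
    using md by (auto simp: martingale_difference_def)
  interpret S: finite_measure_subalgebra M "F N"
    by unfold_locales (rule sub)
  have vF: "v n \<in> borel_measurable (F N)" if "n \<in> {1..N}" for n
  proof (rule measurable_from_subalg)
    show "v n \<in> borel_measurable (F n)"
      using md that by (auto simp: martingale_difference_def)
    show "subalgebra (F N) (F n)"
      using filtration.space_F[OF filt] filtration.sets_F_mono[OF filt, of n N] that
      by (auto simp: subalgebra_def)
  qed
  have vM: "v (Suc N) \<in> borel_measurable M"
    using md sub[of "Suc N"] by (auto simp: martingale_difference_def intro: measurable_from_subalg)
  define f where "f = (\<lambda>\<omega>. ennreal (exp (\<Sum>n=1..N. w n * v n \<omega>)))"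
  define g where "g = (\<lambda>\<omega>. ennreal (exp (w (Suc N) * v (Suc N) \<omega>)))"
  define K where "K = ennreal (exp ((w (Suc N))\<^sup>2 * R\<^sup>2 / 2))"
  have f: "f \<in> borel_measurable (F N)"
    unfolding f_def using vF
    by (intro measurable_compose[OF _ measurable_ennreal] borel_measurable_exp[THEN measurable_compose[rotated]]
        borel_measurable_sum borel_measurable_times) auto
  have fM: "f \<in> borel_measurable M"
    by (rule measurable_from_subalg[OF sub f])
  have g: "g \<in> borel_measurable M"
    unfolding g_def using vM by measurable
  have K: "AE \<omega> in M. nn_cond_exp M (F N) g \<omega> \<le> K"
    using sg[unfolded cond_sub_gaussian_def, rule_format, of "Suc N" "w (Suc N)"]
    by (simp add: g_def K_def)
  have "(\<integral>\<^sup>+\<omega>. ennreal (exp (\<Sum>n=1..Suc N. w n * v n \<omega>)) \<partial>M) = (\<integral>\<^sup>+\<omega>. f \<omega> * g \<omega> \<partial>M)"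
    by (simp add: f_def g_def exp_add ennreal_mult)
  also have "\<dots> = (\<integral>\<^sup>+\<omega>. f \<omega> * nn_cond_exp M (F N) g \<omega> \<partial>M)"
    by (rule S.nn_cond_exp_intg[OF f g, symmetric])
  also have "\<dots> \<le> (\<integral>\<^sup>+\<omega>. f \<omega> * K \<partial>M)"
    using K by (intro nn_integral_mono_AE) (auto elim!: eventually_mono intro: mult_left_mono)
  also have "\<dots> = (\<integral>\<^sup>+\<omega>. f \<omega> \<partial>M) * K"
    by (rule nn_integral_multc[OF fM])
  also have "\<dots> \<le> ennreal (exp (R\<^sup>2 / 2 * (\<Sum>n=1..N. (w n)\<^sup>2))) * K"
    using Suc by (simp add: f_def mult_right_mono)
  also have "\<dots> = ennreal (exp (R\<^sup>2 / 2 * (\<Sum>n=1..Suc N. (w n)\<^sup>2)))"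
    by (simp add: K_def ennreal_mult[symmetric] exp_add[symmetric] algebra_simps)
  finally show ?case .
qed

text \<open>The Chernoff bound conditionally on \<open>Y\<close>: independence permits integrating over the noise first,
  with the weights \<open>W n (Y \<omega>)\<close> held constant. Restricting \<open>Y\<close> to \<open>G\<close> keeps the variance proxy bounded.\<close>
lemma (in prob_space) sub_gaussian_random_weights_tail:
  assumes md: "martingale_difference M F v" and sg: "cond_sub_gaussian M F v R"
    and indep: "indep_random_elements M (Pi\<^sub>M {1..N} (\<lambda>_. borel)) (\<lambda>\<omega>. \<lambda>n\<in>{1..N}. v n \<omega>) T Y"
    and W[measurable]: "\<And>n. n \<in> {1..N} \<Longrightarrow> W n \<in> borel_measurable T"
    and G[measurable]: "G \<in> sets T"
    and V: "\<And>y. y \<in> G \<Longrightarrow> (\<Sum>n=1..N. (W n y)\<^sup>2) \<le> V"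
    and s: "0 \<le> s"
  shows "{\<omega> \<in> space M. Y \<omega> \<in> G \<and> r < (\<Sum>n=1..N. W n (Y \<omega>) * v n \<omega>)} \<in> events"
    and "prob {\<omega> \<in> space M. Y \<omega> \<in> G \<and> r < (\<Sum>n=1..N. W n (Y \<omega>) * v n \<omega>)}
      \<le> exp (s\<^sup>2 * R\<^sup>2 * V / 2 - s * r)"
proof -
  define E where "E = {\<omega> \<in> space M. Y \<omega> \<in> G \<and> r < (\<Sum>n=1..N. W n (Y \<omega>) * v n \<omega>)}"
  define X where "X = (\<lambda>\<omega>. \<lambda>n\<in>{1..N}. v n \<omega>)"
  note joint = indep_random_elements_joint[OF indep[folded X_def]]
  note Y[measurable] = joint(2)
  have v[measurable]: "v n \<in> borel_measurable M" if "n \<in> {1..N}" for n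
    using md that by (auto simp: martingale_difference_def intro: measurable_from_subalg)
  have WY[measurable]: "(\<lambda>\<omega>. W n (Y \<omega>)) \<in> borel_measurable M" if "n \<in> {1..N}" for n
    by (rule measurable_compose[OF Y W[OF that]])
  have [measurable]: "(\<lambda>\<omega>. \<Sum>n=1..N. W n (Y \<omega>) * v n \<omega>) \<in> borel_measurable M"
    by (intro borel_measurable_sum borel_measurable_times WY v)
  show E: "E \<in> events"
    unfolding E_def by measurable
  define f where "f = (\<lambda>(y, x). indicator G y * ennreal (exp (\<Sum>n=1..N. (s * W n y) * x n)))"
  have f: "f \<in> borel_measurable (T \<Otimes>\<^sub>M Pi\<^sub>M {1..N} (\<lambda>_. borel))"
  proof -
    have "(\<lambda>z. W n (fst z)) \<in> borel_measurable (T \<Otimes>\<^sub>M Pi\<^sub>M {1..N} (\<lambda>_. borel :: real measure))"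
      "(\<lambda>z. snd z n) \<in> borel_measurable (T \<Otimes>\<^sub>M Pi\<^sub>M {1..N} (\<lambda>_. borel :: real measure))"
      if "n \<in> {1..N}" for n
      using measurable_compose[OF measurable_fst W[OF that]]
        measurable_compose[OF measurable_snd measurable_component_singleton[OF that]] by auto
    then have [measurable]: "(\<lambda>z. \<Sum>n=1..N. (s * W n (fst z)) * snd z n)
        \<in> borel_measurable (T \<Otimes>\<^sub>M Pi\<^sub>M {1..N} (\<lambda>_. borel :: real measure))"
      by (intro borel_measurable_sum borel_measurable_times borel_measurable_const)
    show ?thesis
      unfolding f_def case_prod_beta by measurable
  qed
  have "emeasure M E = (\<integral>\<^sup>+\<omega>. indicator E \<omega> \<partial>M)"
    using E by simp
  also have "\<dots> \<le> (\<integral>\<^sup>+\<omega>. ennreal (exp (- (s * r))) * f (Y \<omega>, X \<omega>) \<partial>M)"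
  proof (rule nn_integral_mono)
    fix \<omega>
    show "indicator E \<omega> \<le> ennreal (exp (- (s * r))) * f (Y \<omega>, X \<omega>)"
    proof (cases "\<omega> \<in> E")
      case True
      then have "s * r \<le> s * (\<Sum>n=1..N. W n (Y \<omega>) * v n \<omega>)"
        using s by (intro mult_left_mono) (auto simp: E_def)
      then have "1 \<le> exp (- (s * r)) * exp (\<Sum>n=1..N. (s * W n (Y \<omega>)) * X \<omega> n)"
        by (simp add: exp_add[symmetric] X_def sum_distrib_left mult.assoc)
      then show ?thesis
        using True by (simp add: f_def E_def ennreal_mult[symmetric])
    qed simp
  qed
  also have "\<dots> = ennreal (exp (- (s * r))) * (\<integral>\<^sup>+\<omega>. f (Y \<omega>, X \<omega>) \<partial>M)"
    by (rule nn_integral_cmult)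
      (rule measurable_compose[OF measurable_Pair[OF joint(2,1)] f])
  also have "(\<integral>\<^sup>+\<omega>. f (Y \<omega>, X \<omega>) \<partial>M) = (\<integral>\<^sup>+\<omega>. (\<integral>\<^sup>+\<omega>'. f (Y \<omega>, X \<omega>') \<partial>M) \<partial>M)"
    by (rule nn_integral_product_distr[OF joint(2,1,3) f])
  also have "\<dots> \<le> (\<integral>\<^sup>+\<omega>. ennreal (exp (s\<^sup>2 * R\<^sup>2 * V / 2)) \<partial>M)"
  proof (rule nn_integral_mono)
    fix \<omega>
    show "(\<integral>\<^sup>+\<omega>'. f (Y \<omega>, X \<omega>') \<partial>M) \<le> ennreal (exp (s\<^sup>2 * R\<^sup>2 * V / 2))"
    proof (cases "Y \<omega> \<in> G")
      case True
      have "(\<integral>\<^sup>+\<omega>'. f (Y \<omega>, X \<omega>') \<partial>M)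
          = (\<integral>\<^sup>+\<omega>'. ennreal (exp (\<Sum>n=1..N. (s * W n (Y \<omega>)) * v n \<omega>')) \<partial>M)"
        using True by (simp add: f_def X_def)
      also have "\<dots> \<le> ennreal (exp (R\<^sup>2 / 2 * (\<Sum>n=1..N. (s * W n (Y \<omega>))\<^sup>2)))"
        by (rule sub_gaussian_sum[OF md sg])
      also have "\<dots> \<le> ennreal (exp (s\<^sup>2 * R\<^sup>2 * V / 2))"
        using mult_left_mono[OF V[OF True], of "s\<^sup>2 * R\<^sup>2 / 2"]
        by (intro ennreal_leI) (simp add: power_mult_distrib sum_distrib_left[symmetric] mult_ac)
      finally show ?thesis .
    qed (simp add: f_def)
  qed
  also have "\<dots> = ennreal (exp (s\<^sup>2 * R\<^sup>2 * V / 2))"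
    by (simp add: emeasure_space_1)
  finally have "ennreal (prob E) \<le> ennreal (exp (- (s * r))) * ennreal (exp (s\<^sup>2 * R\<^sup>2 * V / 2))"
    by (simp add: emeasure_eq_measure mult_left_mono)
  also have "\<dots> = ennreal (exp (s\<^sup>2 * R\<^sup>2 * V / 2 - s * r))"
    by (simp add: ennreal_mult[symmetric] exp_add[symmetric])
  finally show "prob E \<le> exp (s\<^sup>2 * R\<^sup>2 * V / 2 - s * r)"
    by simp
qed

section \<open>The error of the least squares estimator\<close>

text \<open>Cramer's rule gives a solution that is visibly measurable in the coefficients, in contrast to
  \<open>matrix_inv\<close>, which is defined by choice.\<close>
definition cramer_solution :: "real^'n^'n \<Rightarrow> real^'n \<Rightarrow> real^'n" where
  "cramer_solution A b = (\<chi> k. det (\<chi> i j. if j = k then b $ i else A $ i $ j) / det A)"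

lemma cramer_solution: "det A \<noteq> 0 \<Longrightarrow> A *v cramer_solution A b = b"
  using cramer[of A "cramer_solution A b" b] by (simp add: cramer_solution_def)

lemma borel_measurable_det:
  fixes A :: "'w \<Rightarrow> real^'n^'n"
  assumes "\<And>i j. (\<lambda>\<omega>. A \<omega> $ i $ j) \<in> borel_measurable M"
  shows "(\<lambda>\<omega>. det (A \<omega>)) \<in> borel_measurable M"
  unfolding det_def
  by (intro borel_measurable_sum borel_measurable_times borel_measurable_const borel_measurable_prod assms)

lemma borel_measurable_cramer_solution:
  fixes A :: "'w \<Rightarrow> real^'n^'n"
  assumes A: "\<And>i j. (\<lambda>\<omega>. A \<omega> $ i $ j) \<in> borel_measurable M"
  shows "(\<lambda>\<omega>. cramer_solution (A \<omega>) b $ k) \<in> borel_measurable M"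
proof -
  have "(\<lambda>\<omega>. det (\<chi> i j. if j = k then b $ i else A \<omega> $ i $ j)) \<in> borel_measurable M"
  proof (rule borel_measurable_det)
    show "(\<lambda>\<omega>. (\<chi> i j. if j = k then b $ i else A \<omega> $ i $ j) $ i $ j) \<in> borel_measurable M" for i j
      using A by (cases "j = k") simp_all
  qed
  then show ?thesis
    using borel_measurable_det[OF A] by (simp add: cramer_solution_def)
qed

lemma gram_mult: "gram a N *v u = (\<Sum>n=1..N. (a n \<bullet> u) *\<^sub>R a n)"
proof (rule vec_eq_iff[THEN iffD2, rule_format])
  fix i
  have "(gram a N *v u) $ i = (\<Sum>j\<in>UNIV. \<Sum>n=1..N. a n $ i * a n $ j * u $ j)"
    by (simp add: matrix_vector_mult_def gram_def sum_distrib_right)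
  also have "\<dots> = (\<Sum>n=1..N. \<Sum>j\<in>UNIV. a n $ i * a n $ j * u $ j)"
    by (rule sum.swap)
  finally show "(gram a N *v u) $ i = (\<Sum>n=1..N. (a n \<bullet> u) *\<^sub>R a n) $ i"
    by (simp add: inner_vec_def sum_distrib_left mult_ac)
qed

lemma inner_gram: "u \<bullet> (gram a N *v u) = gram_form a N u"
  by (simp add: gram_mult gram_form_def inner_sum_right power2_eq_square inner_commute)

lemma gram_sym: "transpose (gram a N) = gram a N"
  by (simp add: transpose_def gram_def vec_eq_iff mult.commute)

lemma gram_rhs_sum: "gram_rhs a x N = (\<Sum>n=1..N. x n *\<^sub>R a n)"
  by (simp add: gram_rhs_def vec_eq_iff mult.commute)

text \<open>With \<open>z\<close> the \<open>i\<close>-th column of the inverse Gram matrix, the \<open>i\<close>-th component of the error is a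
  linear form in the noise whose weights \<open>a n \<bullet> z\<close> depend on the design only.\<close>
lemma least_squares_error:
  fixes a :: "nat \<Rightarrow> real^'p"
  assumes inv: "det (gram a N) \<noteq> 0"
    and model: "\<And>n. n \<in> {1..N} \<Longrightarrow> x n = a n \<bullet> \<theta> + v n"
  shows "(least_squares a x N - \<theta>) $ i
    = (\<Sum>n=1..N. (a n \<bullet> cramer_solution (gram a N) (axis i 1)) * v n)"
proof -
  define z where "z = cramer_solution (gram a N) (axis i 1)"
  have z: "gram a N *v z = axis i 1"
    unfolding z_def by (rule cramer_solution[OF inv])
  have "gram a N ** matrix_inv (gram a N) = mat 1"
    using inv someI_ex[of "\<lambda>B. gram a N ** B = mat 1 \<and> B ** gram a N = mat 1"]
    by (simp add: invertible_det_nz[symmetric] invertible_def matrix_inv_def)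
  then have "gram a N *v least_squares a x N = gram_rhs a x N"
    by (simp add: least_squares_def matrix_vector_mul_assoc)
  also have "\<dots> = (\<Sum>n=1..N. (a n \<bullet> \<theta>) *\<^sub>R a n) + (\<Sum>n=1..N. v n *\<^sub>R a n)"
    unfolding gram_rhs_sum sum.distrib[symmetric]
    by (intro sum.cong refl) (simp add: model scaleR_add_left)
  finally have e: "gram a N *v (least_squares a x N - \<theta>) = (\<Sum>n=1..N. v n *\<^sub>R a n)"
    by (simp add: matrix_vector_mult_diff_distrib gram_mult)
  have "(least_squares a x N - \<theta>) $ i = (gram a N *v z) \<bullet> (least_squares a x N - \<theta>)"
    by (simp add: z inner_axis')
  also have "\<dots> = z \<bullet> (\<Sum>n=1..N. v n *\<^sub>R a n)"
    unfolding e[symmetric] by (rule symmetric_matrix_inner[OF gram_sym, symmetric])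
  also have "\<dots> = (\<Sum>n=1..N. (a n \<bullet> z) * v n)"
    by (simp add: inner_sum_right inner_commute mult.commute)
  finally show ?thesis by (simp add: z_def)
qed

text \<open>The sum of the squared weights is the \<open>i\<close>-th diagonal entry of the inverse Gram matrix.\<close>
lemma gram_form_cramer_solution:
  assumes "det (gram a N) \<noteq> 0"
  shows "gram_form a N (cramer_solution (gram a N) (axis i 1)) = cramer_solution (gram a N) (axis i 1) $ i"
  using cramer_solution[OF assms, of "axis i 1"] by (simp add: inner_gram[symmetric] inner_axis)

lemma infnorm_le:
  fixes x :: "real^'n"
  assumes "\<And>i. \<bar>x $ i\<bar> \<le> r"
  shows "infnorm x \<le> r"
  unfolding infnorm_cart by (rule cSup_least) (use assms in auto)

section \<open>The non-asymptotic error bound\<close>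
lemma integral_matrix_component:
  fixes f :: "'w \<Rightarrow> real^'n^'m"
  assumes f: "\<And>i j. integrable M (\<lambda>\<omega>. f \<omega> $ i $ j)"
  shows "(LINT \<omega>|M. f \<omega>) $ i $ j = (LINT \<omega>|M. f \<omega> $ i $ j)"
proof -
  have unit: "(axis k (axis l 1) :: real^'n^'m) $ i $ j = (if k = i then if l = j then 1 else 0 else 0)"
    for k i l j
    by (simp add: axis_def)
  have "(\<Sum>l\<in>UNIV. c l * (if k = i then if l = j then 1 else 0 else 0)) = (if k = i then c j else 0)"
    for c :: "'n \<Rightarrow> real" and k i :: 'm and j
    by (cases "k = i") (simp_all add: mult_delta_right)
  then have "f = (\<lambda>\<omega>. \<Sum>k\<in>UNIV. \<Sum>l\<in>UNIV. (f \<omega> $ k $ l) *\<^sub>R axis k (axis l 1))"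
    by (simp add: fun_eq_iff vec_eq_iff unit)
  moreover have "integrable M (\<lambda>\<omega>. \<Sum>k\<in>UNIV. \<Sum>l\<in>UNIV. (f \<omega> $ k $ l) *\<^sub>R (axis k (axis l 1) :: real^'n^'m))"
    by (intro Bochner_Integration.integrable_sum integrable_scaleR_left f)
  ultimately have "integrable M f"
    by simp
  moreover have "bounded_linear (\<lambda>A :: real^'n^'m. A $ i $ j)"
    by (rule bounded_linear_compose[OF bounded_linear_vec_nth bounded_linear_vec_nth])
  ultimately show ?thesis
    using integral_bounded_linear by fastforce
qed

lemma borel_measurable_component:
  fixes f :: "'w \<Rightarrow> real^'n"
  assumes "f \<in> borel_measurable M"
  shows "(\<lambda>\<omega>. f \<omega> $ i) \<in> borel_measurable M"
  by (rule borel_measurable_continuous_on[OF _ assms]) (intro continuous_intros)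

text \<open>As the averages over the first \<open>n\<close> and the first \<open>n - 1\<close> rows coincide, every single row has
  the second moment matrix \<open>B\<close>.\<close>
lemma (in prob_space) stationary_gram_moment:
  fixes a :: "nat \<Rightarrow> 'a \<Rightarrow> real^'p"
  assumes int: "\<And>n i j. 1 \<le> n \<Longrightarrow> integrable M (\<lambda>\<omega>. a n \<omega> $ i * a n \<omega> $ j)"
    and B: "\<And>K::nat. K > 0 \<Longrightarrow> B = (1 / real K) *\<^sub>R (LINT \<omega>|M. gram (\<lambda>n. a n \<omega>) K)"
    and n: "1 \<le> n"
  shows "expectation (\<lambda>\<omega>. (w \<bullet> a n \<omega>)\<^sup>2) = w \<bullet> (B *v w)"
    and "transpose B = B"
proof -
  have S: "real K * B $ i $ j = (\<Sum>k=1..K. expectation (\<lambda>\<omega>. a k \<omega> $ i * a k \<omega> $ j))" for K i j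
  proof (cases "K = 0")
    case False
    have g: "integrable M (\<lambda>\<omega>. gram (\<lambda>n. a n \<omega>) K $ i $ j)" for i j
      unfolding gram_def vec_lambda_beta by (intro Bochner_Integration.integrable_sum int) simp
    have "real K * B $ i $ j = (LINT \<omega>|M. gram (\<lambda>n. a n \<omega>) K) $ i $ j"
      using B[of K] False by simp
    also have "\<dots> = expectation (\<lambda>\<omega>. gram (\<lambda>n. a n \<omega>) K $ i $ j)"
      by (rule integral_matrix_component[OF g])
    also have "\<dots> = (\<Sum>k=1..K. expectation (\<lambda>\<omega>. a k \<omega> $ i * a k \<omega> $ j))"
      by (simp add: gram_def int)
    finally show ?thesis .
  qed simp
  have E: "expectation (\<lambda>\<omega>. a n \<omega> $ i * a n \<omega> $ j) = B $ i $ j" for i j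
    using S[of n i j] S[of "n - 1" i j] n by (cases n) (simp_all add: algebra_simps)
  show "transpose B = B"
    by (simp add: vec_eq_iff transpose_def E[symmetric] mult.commute)
  have "expectation (\<lambda>\<omega>. (w \<bullet> a n \<omega>)\<^sup>2)
      = expectation (\<lambda>\<omega>. \<Sum>i\<in>UNIV. \<Sum>j\<in>UNIV. (w $ i * w $ j) * (a n \<omega> $ i * a n \<omega> $ j))"
    by (simp add: inner_vec_def power2_eq_square sum_product mult_ac)
  also have "\<dots> = (\<Sum>i\<in>UNIV. \<Sum>j\<in>UNIV. (w $ i * w $ j) * B $ i $ j)"
    using n by (simp add: int E)
  also have "\<dots> = w \<bullet> (B *v w)"
    by (simp add: inner_vec_def matrix_vector_mult_def sum_distrib_left mult_ac)
  finally show "expectation (\<lambda>\<omega>. (w \<bullet> a n \<omega>)\<^sup>2) = w \<bullet> (B *v w)" .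
qed

theorem mainTheorem2:
  fixes \<mu> :: "'w measure"
    and a :: "nat \<Rightarrow> 'w \<Rightarrow> real^'p"
    and v x :: "nat \<Rightarrow> 'w \<Rightarrow> real"
    and F :: "nat \<Rightarrow> 'w measure"
    and M :: "real^'p^'p"
    and \<theta>\<^sub>0 :: "real^'p"
    and \<alpha> R r \<epsilon> \<sigma>max \<sigma>min :: real
    and N :: nat
  assumes prob: "prob_space \<mu>"
    and rows_indep: "prob_space.indep_vars \<mu> (\<lambda>_. borel) a {1..}"
    and model: "\<And>n \<omega>. n \<ge> 1 \<Longrightarrow> \<omega> \<in> space \<mu> \<Longrightarrow> x n \<omega> = a n \<omega> \<bullet> \<theta>\<^sub>0 + v n \<omega>"
    and zero_mean: "\<And>n. n \<ge> 1 \<Longrightarrow> (LINT \<omega>|\<mu>. v n \<omega>) = 0"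
    and A1: "\<And>n i. n \<ge> 1 \<Longrightarrow> \<P>(\<omega> in \<mu>. \<bar>a n \<omega> $ i\<bar> \<le> \<alpha>) = 1"
    and A2: "\<And>K::nat. K > 0 \<Longrightarrow> M = (1 / real K) *\<^sub>R (LINT \<omega>|\<mu>. gram (\<lambda>n. a n \<omega>) K)"
    and \<sigma>max: "\<sigma>max = lambda_max M"
    and \<sigma>min: "\<sigma>min = lambda_min M"
    and \<sigma>min_pos: "\<sigma>min > 0"
    and A6: "martingale_difference \<mu> F v"
    and A6_indep: "\<And>K::nat. indep_random_elements \<mu>
          (Pi\<^sub>M {1..K} (\<lambda>_. borel)) (\<lambda>\<omega>. \<lambda>n\<in>{1..K}. v n \<omega>)
          (Pi\<^sub>M {1..K} (\<lambda>_. borel)) (\<lambda>\<omega>. \<lambda>n\<in>{1..K}. a n \<omega>)"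
    and A8: "cond_sub_gaussian \<mu> F v R"
    and \<epsilon>: "\<epsilon> > 0"
    and r: "r > 0"
    and N_gt_p: "N > CARD('p)"
    and ls_exists: "AE \<omega> in \<mu>. invertible (gram (\<lambda>n. a n \<omega>) N)"
    and N_gt: "real N > max (N1_bound \<alpha> R CARD('p) \<sigma>min r \<epsilon>)
                            (Nrand_bound \<alpha> CARD('p) \<sigma>max \<sigma>min \<epsilon>)"
  shows "\<P>(\<omega> in \<mu>. infnorm (least_squares (\<lambda>n. a n \<omega>) (\<lambda>n. x n \<omega>) N - \<theta>\<^sub>0) > r) < \<epsilon>"
proof (cases "\<epsilon> \<le> 1")
  case False
  then show ?thesis
    using prob_space.prob_le_1[OF prob] by (meson le_less_trans not_le)
next
  case \<epsilon>1: True
  interpret prob_space \<mu> by (rule prob)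
  define p where "p = real CARD('p)"
  define L where "L = p * \<alpha>\<^sup>2"
  define q where "q = ln (2 * p / \<epsilon>)"
  have p: "1 \<le> p"
    by (simp add: p_def Suc_leI)
  have am[measurable]: "a n \<in> borel_measurable \<mu>" if "1 \<le> n" for n
    using rows_indep that by (auto simp: indep_vars_def2)
  have aim[measurable]: "(\<lambda>\<omega>. a n \<omega> $ i) \<in> borel_measurable \<mu>" if "1 \<le> n" for n i
    by (rule borel_measurable_component[OF am[OF that]])
  have abs_a: "AE \<omega> in \<mu>. \<forall>i. \<bar>a n \<omega> $ i\<bar> \<le> \<alpha>" if n: "1 \<le> n" for n
  proof -
    have "AE \<omega> in \<mu>. \<bar>a n \<omega> $ i\<bar> \<le> \<alpha>" for i
    proof -
      have "{\<omega> \<in> space \<mu>. \<bar>a n \<omega> $ i\<bar> \<le> \<alpha>} \<in> events"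
        using aim[OF n] by measurable
      then show ?thesis
        using AE_prob_1[OF A1[OF n, of i]] by (auto elim: eventually_mono)
    qed
    then have "AE \<omega> in \<mu>. \<forall>i\<in>UNIV. \<bar>a n \<omega> $ i\<bar> \<le> \<alpha>"
      by (intro AE_finite_allI) auto
    then show ?thesis by simp
  qed
  have \<alpha>_sq: "(a n \<omega> $ i)\<^sup>2 \<le> \<alpha>\<^sup>2" if "\<forall>i. \<bar>a n \<omega> $ i\<bar> \<le> \<alpha>" for n \<omega> i
    using that by (metis abs_le_square_iff abs_ge_zero abs_of_nonneg order_trans)
  have int: "integrable \<mu> (\<lambda>\<omega>. a n \<omega> $ i * a n \<omega> $ j)" if n: "1 \<le> n" for n i j
  proof (rule integrable_const_bound)
    show "AE \<omega> in \<mu>. norm (a n \<omega> $ i * a n \<omega> $ j) \<le> \<alpha> * \<alpha>"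
      using abs_a[OF n] by eventually_elim (auto simp: abs_mult intro!: mult_mono intro: order_trans[OF abs_ge_zero])
  qed (use aim[OF n] in measurable)
  note moment = stationary_gram_moment[OF int A2]
  have sym: "transpose M = M"
    by (rule moment(2)[OF _ _ order_refl])
  have second: "\<sigma>min * (w \<bullet> w) \<le> expectation (\<lambda>\<omega>. (w \<bullet> a n \<omega>)\<^sup>2)" if "1 \<le> n" for n w
    using lambda_min_le_rayleigh[OF sym, of w] moment(1)[of n w] that by (simp add: \<sigma>min)
  have \<sigma>min_le_max: "\<sigma>min \<le> \<sigma>max"
    using lambda_min_le_lambda_max[OF sym] by (simp add: \<sigma>min \<sigma>max)
  have \<sigma>min_le: "\<sigma>min \<le> \<alpha>\<^sup>2"
  proof -
    fix i :: 'p
    have "\<sigma>min \<le> expectation (\<lambda>\<omega>. a 1 \<omega> $ i * a 1 \<omega> $ i)"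
      using second[of 1 "axis i 1"] by (simp add: inner_axis' power2_eq_square)
    also have "\<dots> \<le> expectation (\<lambda>\<omega>. \<alpha>\<^sup>2)"
      using int[of 1 i i] abs_a[of 1] \<alpha>_sq
      by (intro integral_mono_AE) (auto simp: power2_eq_square elim!: eventually_mono)
    finally show ?thesis
      by (simp add: prob_space)
  qed
  have L_pos: "0 < L"
    unfolding L_def by (rule mult_pos_pos) (use p \<sigma>min_le \<sigma>min_pos in linarith)+
  have bounded: "AE \<omega> in \<mu>. a n \<omega> \<bullet> a n \<omega> \<le> L" if n: "1 \<le> n" for n
    using abs_a[OF n]
  proof eventually_elim
    case (elim \<omega>)
    have "a n \<omega> \<bullet> a n \<omega> \<le> (\<Sum>i\<in>(UNIV :: 'p set). \<alpha>\<^sup>2)"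
      unfolding inner_vec_def by (intro sum_mono) (use \<alpha>_sq[OF elim] in \<open>simp add: power2_eq_square\<close>)
    then show ?case by (simp add: L_def p_def)
  qed
  interpret rows: bounded_independent_rows \<mu> a L \<sigma>min
    by unfold_locales (use rows_indep bounded second L_pos \<sigma>min_pos in auto)

  have N_pos: "0 < real N"
    using N_gt_p by simp
  have q_pos: "0 < q"
    using p \<epsilon> \<epsilon>1 by (simp add: q_def ln_gt_zero)
  have exp_q: "exp (- q) = \<epsilon> / (2 * p)"
    using p \<epsilon> by (simp add: q_def exp_minus)
  have N1: "8 * \<alpha>\<^sup>2 * R\<^sup>2 / (r\<^sup>2 * \<sigma>min\<^sup>2) * q < real N"
    and Nrand: "4 / 3 * ((6 * \<sigma>max + \<sigma>min) * (L + \<sigma>max) / \<sigma>min\<^sup>2) * q < real N"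
    using N_gt by (simp_all add: N1_bound_def Nrand_bound_def q_def p_def L_def)

  \<comment> \<open>The second threshold is at least \<open>28 / 3 * (L / \<sigma>min) * q\<close>, because \<open>\<sigma>max \<ge> \<sigma>min\<close>; the tail bound for the Gram form asks for 8 in place of 28/3.\<close>
  have q_rand: "q < real N * \<sigma>min / (8 * L)"
  proof -
    have "6 * (\<sigma>min * L) \<le> 6 * ((\<sigma>max) * (L + \<sigma>max)) * 1"
      using \<sigma>min_le_max \<sigma>min_pos L_pos by (auto intro!: mult_mono)
    moreover have "\<sigma>min * L \<le> \<sigma>min * (L + \<sigma>max)"
      using \<sigma>min_le_max \<sigma>min_pos by simp
    ultimately have "7 * (\<sigma>min * L) \<le> (6 * \<sigma>max + \<sigma>min) * (L + \<sigma>max)"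
      by (simp add: algebra_simps)
    then have "4 / 3 * (7 * (\<sigma>min * L) / \<sigma>min\<^sup>2) * q
        \<le> 4 / 3 * ((6 * \<sigma>max + \<sigma>min) * (L + \<sigma>max) / \<sigma>min\<^sup>2) * q"
      using q_pos by (intro mult_right_mono mult_left_mono divide_right_mono) auto
    then have "4 / 3 * (7 * (\<sigma>min * L) / \<sigma>min\<^sup>2) * q < real N"
      using Nrand by simp
    then have "28 / 3 * (L * q) < real N * \<sigma>min"
      using \<sigma>min_pos by (simp add: field_simps power2_eq_square)
    moreover have "8 * (L * q) \<le> 28 / 3 * (L * q)"
      using L_pos q_pos by simp
    ultimately have "8 * (L * q) < real N * \<sigma>min"
      by linarith
    then show ?thesis
      using L_pos by (simp add: pos_less_divide_eq mult_ac)
  qed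

  \<comment> \<open>\<open>G i\<close> is the set of designs for which the \<open>i\<close>-th diagonal entry of the inverse Gram matrix is at
    most \<open>V\<close>, which holds if the Gram form is at least \<open>1 / V\<close>. \<open>B\<close> collects the other invertible
    designs, and \<open>E i 1\<close>, \<open>E i (- 1)\<close> the two signs of a large \<open>i\<close>-th error on \<open>G i\<close>.\<close>
  define T where "T = Pi\<^sub>M {1..N} (\<lambda>_. borel :: (real^'p) measure)"
  define Y where "Y = (\<lambda>\<omega>. \<lambda>n\<in>{1..N}. a n \<omega>)"
  define V where "V = 2 / (real N * \<sigma>min)"
  define z where "z = (\<lambda>i y. cramer_solution (gram y N) (axis i 1) :: real^'p)"
  define W where "W = (\<lambda>i n y. y n \<bullet> z i y)"
  define G where "G = (\<lambda>i. {y \<in> space T. det (gram y N) \<noteq> 0 \<and> z i y $ i \<le> V})"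
  define B where "B = {\<omega> \<in> space \<mu>. det (gram (Y \<omega>) N) \<noteq> 0 \<and> (\<exists>i. V < z i (Y \<omega>) $ i)}"
  define E where "E = (\<lambda>i \<tau>. {\<omega> \<in> space \<mu>. Y \<omega> \<in> G i \<and> r < (\<Sum>n=1..N. (\<tau> * W i n (Y \<omega>)) * v n \<omega>)})"
  have V_pos: "0 < V"
    using N_pos \<sigma>min_pos by (simp add: V_def)
  have gram_Y: "gram (Y \<omega>) N = gram (\<lambda>n. a n \<omega>) N" for \<omega>
    by (auto simp: gram_def vec_eq_iff Y_def intro!: sum.cong)
  have gf_Y: "gram_form (Y \<omega>) N u = gram_form (\<lambda>n. a n \<omega>) N u" for \<omega> u
    by (auto simp: gram_form_def Y_def intro!: sum.cong)
  have comp[measurable]: "(\<lambda>y. y n) \<in> borel_measurable T" if "n \<in> {1..N}" for n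
    unfolding T_def by (rule measurable_component_singleton[OF that])
  have gram_m: "(\<lambda>y. gram y N $ i $ j) \<in> borel_measurable T" for i j
    unfolding gram_def vec_lambda_beta
    by (intro borel_measurable_sum borel_measurable_times borel_measurable_component comp)
  have det_m[measurable]: "(\<lambda>y. det (gram y N)) \<in> borel_measurable T"
    by (rule borel_measurable_det[OF gram_m])
  have z_m[measurable]: "(\<lambda>y. z i y $ k) \<in> borel_measurable T" for i k
    unfolding z_def by (rule borel_measurable_cramer_solution[OF gram_m])
  have W_m: "W i n \<in> borel_measurable T" if "n \<in> {1..N}" for i n
    unfolding W_def inner_vec_def inner_real_def
    by (intro borel_measurable_sum borel_measurable_times borel_measurable_component comp z_m that)
  have G_m: "G i \<in> sets T" for i
    unfolding G_def by measurable
  have Y_m[measurable]: "Y \<in> measurable \<mu> T"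
    unfolding Y_def T_def by (rule measurable_restrict) (simp add: am)
  have W_sq: "(\<Sum>n=1..N. (W i n y)\<^sup>2) = z i y $ i" if "det (gram y N) \<noteq> 0" for i y
    using gram_form_cramer_solution[OF that, of i] by (simp add: gram_form_def W_def z_def)

  have B_m: "B \<in> events"
    unfolding B_def by measurable
  have "prob B \<le> real DIM(real^'p) * exp (- (real N * \<sigma>min / (8 * L)))"
  proof (rule rows.prob_small_gram_form_le[OF B_m], intro AE_I2 impI)
    fix \<omega> assume "\<omega> \<in> B"
    then obtain i where d: "det (gram (Y \<omega>) N) \<noteq> 0" and i: "V < z i (Y \<omega>) $ i"
      by (auto simp: B_def)
    define u where "u = z i (Y \<omega>)"
    have "gram_form (\<lambda>n. a n \<omega>) N u = u $ i"
      using gram_form_cramer_solution[OF d, of i] by (simp add: gf_Y u_def z_def)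
    also have "\<dots> \<le> (1 / V) * (u $ i)\<^sup>2"
      using i V_pos by (simp add: u_def power2_eq_square field_simps)
    also have "\<dots> \<le> (1 / V) * (u \<bullet> u)"
      using V_pos component_le_norm_cart[of u i]
      by (intro mult_left_mono) (auto simp: dot_square_norm abs_le_square_iff[symmetric])
    also have "1 / V = real N * \<sigma>min / 2"
      by (simp add: V_def)
    finally have "gram_form (\<lambda>n. a n \<omega>) N u \<le> real N * \<sigma>min / 2 * (u \<bullet> u)" .
    moreover have "u \<noteq> 0"
      using i V_pos by (auto simp: u_def)
    ultimately show "\<exists>u. u \<noteq> 0 \<and> gram_form (\<lambda>n. a n \<omega>) N u \<le> real N * \<sigma>min / 2 * (u \<bullet> u)"
      by blast
  qed
  also have "\<dots> < p * exp (- q)"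
    using q_rand p by (simp add: p_def)
  also have "\<dots> = \<epsilon> / 2"
    using p by (simp add: exp_q)
  finally have prob_B: "prob B < \<epsilon> / 2" .

  have E_bound: "E i \<tau> \<in> events \<and> prob (E i \<tau>) \<le> exp (- (2 * q))" if \<tau>: "\<tau>\<^sup>2 = 1" for i \<tau>
  proof -
    \<comment> \<open>With this \<open>s\<close> the linear term is \<open>4 q\<close>, and the quadratic term is at most \<open>2 q\<close> because
      \<open>N\<close> exceeds the first threshold. The value is meaningful for \<open>R = 0\<close> as well.\<close>
    define s where "s = 4 * q / r"
    have s0: "0 \<le> s"
      using q_pos r by (simp add: s_def)
    have \<tau>W: "(\<lambda>y. \<tau> * W i n y) \<in> borel_measurable T" if "n \<in> {1..N}" for n
      by (intro borel_measurable_times borel_measurable_const W_m that)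
    have "(\<Sum>n=1..N. (\<tau> * W i n y)\<^sup>2) \<le> V" if "y \<in> G i" for y
      using that W_sq[of y i] \<tau> by (simp add: G_def power_mult_distrib)
    note tail = sub_gaussian_random_weights_tail[OF A6 A8 A6_indep[of N, folded T_def Y_def]
        \<tau>W G_m[of i] this s0, where r = r]
    have "8 * \<sigma>min * R\<^sup>2 * q \<le> 8 * \<alpha>\<^sup>2 * R\<^sup>2 * q"
      using \<sigma>min_le q_pos by (intro mult_right_mono mult_left_mono) auto
    also have "\<dots> \<le> real N * (r\<^sup>2 * \<sigma>min\<^sup>2)"
      using N1 r \<sigma>min_pos by (simp add: field_simps)
    finally have "8 * R\<^sup>2 * q \<le> real N * r\<^sup>2 * \<sigma>min"
      using \<sigma>min_pos by (simp add: power2_eq_square algebra_simps)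
    then have RV: "R\<^sup>2 * V * (4 * q) \<le> r\<^sup>2"
      using N_pos \<sigma>min_pos by (simp add: V_def field_simps)
    have "s\<^sup>2 * R\<^sup>2 * V / 2 = (2 * q / r\<^sup>2) * (R\<^sup>2 * V * (4 * q))"
      by (simp add: s_def power2_eq_square)
    also have "\<dots> \<le> (2 * q / r\<^sup>2) * r\<^sup>2"
      using RV q_pos by (intro mult_left_mono) auto
    also have "\<dots> = 2 * q"
      using r by simp
    finally have "s\<^sup>2 * R\<^sup>2 * V / 2 - s * r \<le> - (2 * q)"
      using r by (simp add: s_def)
    then show ?thesis
      using tail by (auto simp: E_def intro: order_trans)
  qed

  have cover: "AE \<omega> in \<mu>. \<omega> \<in> {\<omega> \<in> space \<mu>. infnorm (least_squares (\<lambda>n. a n \<omega>) (\<lambda>n. x n \<omega>) N - \<theta>\<^sub>0) > r}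
      \<longrightarrow> \<omega> \<in> B \<union> (\<Union>i. E i 1 \<union> E i (- 1))"
    using ls_exists AE_space
  proof eventually_elim
    case (elim \<omega>)
    define e where "e = least_squares (\<lambda>n. a n \<omega>) (\<lambda>n. x n \<omega>) N - \<theta>\<^sub>0"
    have d: "det (gram (\<lambda>n. a n \<omega>) N) \<noteq> 0"
      using elim(1) by (simp add: invertible_det_nz)
    have e: "e $ i = (\<Sum>n=1..N. W i n (Y \<omega>) * v n \<omega>)" for i
    proof -
      have "e $ i = (\<Sum>n=1..N. (a n \<omega> \<bullet> cramer_solution (gram (\<lambda>n. a n \<omega>) N) (axis i 1)) * v n \<omega>)"
        unfolding e_def by (rule least_squares_error[OF d]) (use model elim(2) in auto)
      also have "\<dots> = (\<Sum>n=1..N. W i n (Y \<omega>) * v n \<omega>)"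
        unfolding W_def z_def gram_Y by (intro sum.cong refl) (simp add: Y_def)
      finally show ?thesis .
    qed
    show ?case
    proof (intro impI, rule ccontr)
      assume big: "\<omega> \<in> {\<omega> \<in> space \<mu>. infnorm (least_squares (\<lambda>n. a n \<omega>) (\<lambda>n. x n \<omega>) N - \<theta>\<^sub>0) > r}"
        and not: "\<omega> \<notin> B \<union> (\<Union>i. E i 1 \<union> E i (- 1))"
      have "\<bar>e $ i\<bar> \<le> r" for i
      proof -
        have "Y \<omega> \<in> G i"
          using not d elim(2) measurable_space[OF Y_m elim(2)] by (auto simp: B_def G_def gram_Y not_less)
        then have "\<not> r < e $ i" "\<not> r < - (e $ i)"
          using not elim(2) by (auto simp: E_def e sum_negf)
        then show ?thesis by auto
      qed
      then show False
        using infnorm_le[of e r] big by (simp add: e_def)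
    qed
  qed
  have E_m: "E i 1 \<union> E i (- 1) \<in> events" for i
    using E_bound by auto
  have "prob {\<omega> \<in> space \<mu>. infnorm (least_squares (\<lambda>n. a n \<omega>) (\<lambda>n. x n \<omega>) N - \<theta>\<^sub>0) > r}
      \<le> prob (B \<union> (\<Union>i. E i 1 \<union> E i (- 1)))"
    by (rule finite_measure_mono_AE[OF cover]) (use B_m E_m in auto)
  also have "\<dots> \<le> prob B + prob (\<Union>i. E i 1 \<union> E i (- 1))"
    by (rule measure_Un_le) (use B_m E_m in auto)
  also have "prob (\<Union>i. E i 1 \<union> E i (- 1)) \<le> (\<Sum>i\<in>UNIV. prob (E i 1 \<union> E i (- 1)))"
    by (rule finite_measure_subadditive_finite) (use E_m in auto)
  also have "\<dots> \<le> (\<Sum>i\<in>(UNIV::'p set). exp (- (2 * q)) + exp (- (2 * q)))"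
  proof (rule sum_mono)
    fix i :: 'p
    have "prob (E i 1 \<union> E i (- 1)) \<le> prob (E i 1) + prob (E i (- 1))"
      by (rule measure_Un_le) (use E_bound in auto)
    then show "prob (E i 1 \<union> E i (- 1)) \<le> exp (- (2 * q)) + exp (- (2 * q))"
      using E_bound[of 1 i] E_bound[of "- 1" i] by simp
  qed
  also have "\<dots> = 2 * p * (exp (- q))\<^sup>2"
    by (simp add: p_def exp_double[symmetric] mult.commute)
  also have "\<dots> = \<epsilon> / 2 * (\<epsilon> / p)"
    using p by (simp add: exp_q power2_eq_square)
  also have "\<dots> \<le> \<epsilon> / 2 * 1"
    using \<epsilon> \<epsilon>1 p by (intro mult_left_mono) auto
  finally show ?thesis
    using prob_B by simp
qed

end
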